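(* Let $(\Omega,d,\mu)$ be a probability metric space satisfying the standing assumptions in the context, let $J$ be an isoperimetric estimator of $(\Omega,d,\mu)$, and let $\bar X$ be a rearrangement invariant space on $(0,1)$. Let $G:(0,1)\to(0,\infty)$ be a (measurable) function such that $$\int_0^{1/2}\frac{t}{J(t)}G(t)\,dt<\infty .$$ Suppose that the isoperimetric Hardy operator $Q_J$ is bounded on $\bar X$. Let $f\in Lip(\Omega)$ and let $med(f)$ be a median of $f$. Then $$\int_0^{1/2}\left\|(f-med(f))^{\ast}(s)\chi_{[0,t)}(s)\right\|_{\bar X}G(t)\,dt\le\left(\|Q\|_{\bar X\to\bar X}+\|Q_J\|_{\bar X\to\bar X}\right)\left\||\nabla f|^{\ast}\right\|_{\bar X}\int_0^{1/2}\frac{t}{J(t)}G(t)\,dt ,$$ where the norm on the left is taken with respect to the variable $s$.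
   Context: Standing assumptions. $(\Omega,d,\mu)$ is a connected metric space with a Borel probability measure $\mu$. For a Borel set $A\subset\Omega$, $P(A;\Omega)=\liminf_{h\to0^+}\frac{\mu(A_h)-\mu(A)}{h}$ with $A_h=\{x\in\Omega:d(x,A)<h\}$. The isoperimetric profile is $I(s)=\inf\{P(A;\Omega):\mu(A)=s\}$, $s\in[0,1]$. It is assumed that $I(0)=0$ and that $I$ is continuous, concave and symmetric about $1/2$. An isoperimetric estimator is a function $J:[0,1/2]\to[0,\infty)$ with the same properties (i.e. $J$ is the restriction to $[0,1/2]$ of a continuous concave function on $[0,1]$, symmetric about $1/2$ and vanishing at $0$) such that $I(t)\ge J(t)$ for $t\in(0,1/2)$. $Lip(\Omega)$ is the set of real-valued Lipschitz functions on $\Omega$, and $|\nabla f(x)|=\limsup_{d(x,y)\to0}\frac{|f(x)-f(y)|}{d(x,y)}$. A median of $f$ is a real number $med(f)$ with $\mu\{f\ge med(f)\}\ge1/2$ and $\mu\{f\le med(f)\}\ge1/2$. For measurable $u:\Omega\to\mathbb R$, $u^{\ast}(s)=\inf\{t\in\mathbb R:\mu\{u>t\}\le s\}$, $s\in[0,1)$ (it may take negative values; the rearrangement of the absolute value is written $|u|^\ast$). $|\nabla f|^\ast$ is the rearrangement of the function $|\nabla f|$ with respect to $\mu$. A rearrangement invariant (r.i.) space $\bar X$ on $(0,1)$ is a Banach function space over $(0,1)$ with Lebesgue measure, with the Fatou property, such that if $g\in\bar X$ and $|f|^\ast=|g|^\ast$ then $f\in\bar X$ and $\|f\|_{\bar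 X}=\|g\|_{\bar X}$. Operators on functions on $(0,1)$: $Qg(t)=\int_t^1 g(s)\frac{ds}{s}$, and the isoperimetric Hardy operator $Q_Jg(t)=\frac{J(t)}{t}\int_t^{1/2}g(z)\frac{dz}{J(z)}$ for $0<t<1/2$ (understood as $0$ for $t\ge1/2$). $\|\cdot\|_{\bar X\to\bar X}$ denotes the operator norm. *)

theory Defs
  imports "HOL-Probability.Probability"
begin

text \<open>The condition \<open>A \<noteq> {}\<close> implements \<open>d(x, {}) = \<infinity>\<close>; the library has \<open>infdist x {} = 0\<close>.\<close>

definition enlargement :: "'a::metric_space set \<Rightarrow> real \<Rightarrow> 'a set" where
  "enlargement A h = {x. A \<noteq> {} \<and> infdist x A < h}"

definition perimeter :: "'a::metric_space measure \<Rightarrow> 'a set \<Rightarrow> ennreal" where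
  "perimeter M A =
     Liminf (at_right 0) (\<lambda>h. ennreal ((measure M (enlargement A h) - measure M A) / h))"

definition iso_profile :: "'a::metric_space measure \<Rightarrow> real \<Rightarrow> ennreal" where
  "iso_profile M s = (INF A\<in>{A \<in> sets borel. measure M A = s}. perimeter M A)"

text \<open>The profile is valued in \<open>[0, \<infinity>]\<close>, with value \<open>\<infinity>\<close> if no Borel set has measure \<open>s\<close>.
  Being a continuous concave real function is taken to include finiteness.\<close>

definition isoperimetric_space :: "'a::metric_space measure \<Rightarrow> bool" where
  "isoperimetric_space M \<longleftrightarrow>
     connected (UNIV :: 'a set) \<and> prob_space M \<and> sets M = sets borel \<and>
     (\<forall>s\<in>{0..1}. iso_profile M s < \<infinity>) \<and>
     iso_profile M 0 = 0 \<and>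
     continuous_on {0..1} (\<lambda>s. enn2real (iso_profile M s)) \<and>
     concave_on {0..1} (\<lambda>s. enn2real (iso_profile M s)) \<and>
     (\<forall>s\<in>{0..1}. iso_profile M (1 - s) = iso_profile M s)"

definition isoperimetric_estimator :: "'a::metric_space measure \<Rightarrow> (real \<Rightarrow> real) \<Rightarrow> bool" where
  "isoperimetric_estimator M J \<longleftrightarrow>
     (\<forall>t\<in>{0..1/2}. 0 \<le> J t) \<and>
     (\<exists>K. continuous_on {0..1} K \<and> concave_on {0..1} K \<and> K 0 = 0 \<and>
          (\<forall>s\<in>{0..1}. K (1 - s) = K s) \<and> (\<forall>t\<in>{0..1/2}. J t = K t)) \<and>
     (\<forall>t\<in>{0<..<1/2}. ennreal (J t) \<le> iso_profile M t)"

text \<open>For Lipschitz functions the upper limit is finite, so \<^const>\<open>enn2real\<close> does not lose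
  information; at an isolated point the value is \<open>0\<close>.\<close>

definition grad_modulus :: "('a::metric_space \<Rightarrow> real) \<Rightarrow> 'a \<Rightarrow> real" where
  "grad_modulus f x = enn2real (Limsup (at x) (\<lambda>y. ennreal (\<bar>f x - f y\<bar> / dist x y)))"

definition is_median :: "'a measure \<Rightarrow> ('a \<Rightarrow> real) \<Rightarrow> real \<Rightarrow> bool" where
  "is_median M f m \<longleftrightarrow>
     measure M {x \<in> space M. f x \<ge> m} \<ge> 1/2 \<and> measure M {x \<in> space M. f x \<le> m} \<ge> 1/2"

text \<open>Only the values for \<open>0 < s < 1\<close> matter below. There, on a probability space, the set is
  nonempty and bounded below. At \<open>s = 0\<close> it is empty if \<open>u\<close> is essentially unbounded above, and the
  real infimum is then not meaningful.\<close>

definition rearrangement :: "'a measure \<Rightarrow> ('a \<Rightarrow> real) \<Rightarrow> real \<Rightarrow> real" where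
  "rearrangement M u s = Inf {t. measure M {x \<in> space M. u x > t} \<le> s}"

abbreviation unit_measure :: "real measure" where
  "unit_measure \<equiv> lebesgue_on {0<..<1}"

text \<open>A Banach function space over \<open>(0,1)\<close> is represented by its norm, extended by the value \<open>\<infinity>\<close>
  to all measurable functions; the axioms are those of Bennett and Sharpley, stated for real-valued
  functions. Functions are total on \<^typ>\<open>real\<close>, but the monotonicity axiom makes the norm depend
  only on the almost everywhere class of the restriction to \<open>(0,1)\<close>. Completeness is a consequence
  of the axioms.\<close>

definition banach_function_norm :: "((real \<Rightarrow> real) \<Rightarrow> ennreal) \<Rightarrow> bool" where
  "banach_function_norm N \<longleftrightarrow>
     (\<forall>f\<in>borel_measurable unit_measure. N f = 0 \<longleftrightarrow> (AE x in unit_measure. f x = 0)) \<and>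
     (\<forall>f\<in>borel_measurable unit_measure. \<forall>c. N (\<lambda>x. c * f x) = ennreal \<bar>c\<bar> * N f) \<and>
     (\<forall>f\<in>borel_measurable unit_measure. \<forall>g\<in>borel_measurable unit_measure.
        N (\<lambda>x. f x + g x) \<le> N f + N g) \<and>
     (\<forall>f\<in>borel_measurable unit_measure. \<forall>g\<in>borel_measurable unit_measure.
        (AE x in unit_measure. \<bar>f x\<bar> \<le> \<bar>g x\<bar>) \<longrightarrow> N f \<le> N g) \<and>
     (\<forall>F. \<forall>f\<in>borel_measurable unit_measure.
        (\<forall>n::nat. F n \<in> borel_measurable unit_measure) \<longrightarrow>
        (AE x in unit_measure. (\<forall>n. 0 \<le> F n x \<and> F n x \<le> F (Suc n) x) \<and> (\<lambda>n. F n x) \<longlonglongrightarrow> f x) \<longrightarrow>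
        (\<lambda>n. N (F n)) \<longlonglongrightarrow> N f) \<and>
     N (\<lambda>x. 1) < \<infinity> \<and>
     (\<exists>C::real. \<forall>f\<in>borel_measurable unit_measure.
        (\<integral>\<^sup>+x. ennreal \<bar>f x\<bar> \<partial>unit_measure) \<le> ennreal C * N f)"

definition bfs_carrier :: "((real \<Rightarrow> real) \<Rightarrow> ennreal) \<Rightarrow> (real \<Rightarrow> real) set" where
  "bfs_carrier N = {f \<in> borel_measurable unit_measure. N f < \<infinity>}"

definition ri_norm :: "((real \<Rightarrow> real) \<Rightarrow> ennreal) \<Rightarrow> bool" where
  "ri_norm N \<longleftrightarrow> banach_function_norm N \<and>
     (\<forall>g\<in>bfs_carrier N. \<forall>f\<in>borel_measurable unit_measure.
        (\<forall>s\<in>{0<..<1}. rearrangement unit_measure (\<lambda>x. \<bar>f x\<bar>) s =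
                      rearrangement unit_measure (\<lambda>x. \<bar>g x\<bar>) s) \<longrightarrow>
        f \<in> bfs_carrier N \<and> N f = N g)"

definition bounded_on :: "((real \<Rightarrow> real) \<Rightarrow> ennreal) \<Rightarrow> ((real \<Rightarrow> real) \<Rightarrow> real \<Rightarrow> real) \<Rightarrow> bool" where
  "bounded_on N T \<longleftrightarrow>
     (\<exists>C::real. \<forall>g\<in>bfs_carrier N. T g \<in> bfs_carrier N \<and> N (T g) \<le> ennreal C * N g)"

definition op_norm :: "((real \<Rightarrow> real) \<Rightarrow> ennreal) \<Rightarrow> ((real \<Rightarrow> real) \<Rightarrow> real \<Rightarrow> real) \<Rightarrow> ennreal" where
  "op_norm N T = (SUP g\<in>{g \<in> bfs_carrier N. N g \<le> 1}. N (T g))"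

definition hardy_Q :: "(real \<Rightarrow> real) \<Rightarrow> real \<Rightarrow> real" where
  "hardy_Q g t = (LINT s:{t<..<1}|lebesgue. g s / s)"

definition iso_hardy_Q :: "(real \<Rightarrow> real) \<Rightarrow> (real \<Rightarrow> real) \<Rightarrow> real \<Rightarrow> real" where
  "iso_hardy_Q J g t =
     (if 0 < t \<and> t < 1/2 then J t / t * (LINT z:{t<..<1/2}|lebesgue. g z / J z) else 0)"

end

theory Submission
  imports Defs
begin

text \<open>Let \<open>R\<close> be the rearrangement of \<open>u = f - m\<close>. Formally, \<open>g = (- R') J\<close> satisfies
  \<open>\<parallel>g\<parallel> \<le> \<parallel>|\<nabla>f|\<^sup>*\<parallel>\<close>, because by the coarea inequality and the isoperimetric inequality
  \<open>J(s) (R(s) - R(t))\<close> is at most the integral of \<open>|\<nabla>f|\<close> over the shell \<open>R(t) < u < R(s)\<close> of measure at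
  most \<open>t - s\<close>, so that \<open>g\<close> is majorized by \<open>|\<nabla>f|\<^sup>*\<close>. As \<open>t / J(t)\<close> increases and the median
  gives \<open>R(1/2) \<le> 0\<close>, for \<open>s < t < 1/2\<close> the value \<open>R(s)\<close> is at most the integral of \<open>g / J\<close>
  over \<open>(s, 1/2)\<close>, which is at most \<open>(t / J(t)) (Q g(s) + Q\<^sub>J g(s))\<close>.
  Instead of differentiating \<open>R\<close>, we use step functions on a grid: majorization is then a
  statement on finite sequences, and the limit is taken by the Fatou property.\<close>

section \<open>Rearrangements\<close>

text \<open>Recovering \<open>R\<close> from its derivative would require local absolute continuity,
  and comparing \<open>g\<close> with \<open>|\<nabla>f|\<^sup>*\<close> in a general r.i. norm
  would require a majorization principle for functions. On a uniform grid both become finite: a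
  transfer between two entries is a convex combination of a sequence and a transposition of it, so
  the triangle inequality and permutation invariance suffice. The price is that each cell samples
  \<open>J\<close> at its left end, while the Hardy operators integrate \<open>1 / J\<close> over
  the cell. Concavity bounds the ratio of neighbouring samples by \<open>1 + 1 / j\<close> in cell
  \<open>j\<close>, which is close to 1 only away from 0. Hence the estimate is first proved for
  \<open>s \<ge> 2^-k\<close> on a grid of mesh \<open>1 / (2 * 4^k)\<close>, where
  \<open>j \<ge> 2^k\<close>, and then \<open>k\<close> tends to infinity. The norm of
  \<open>Q\<close> may be infinite, and infinity times 0 is 0 in \<open>ennreal\<close>; functions
  of norm 0 are therefore treated separately. Positivity of \<open>J\<close>, without which one
  cannot divide by it, comes from the finite weight integral and \<open>G > 0\<close>.\<close>

lemma inverse_Suc_le: "m \<le> n \<Longrightarrow> inverse (real (Suc n)) \<le> inverse (real (Suc m))"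
  by (simp add: field_simps)

text \<open>The distribution function decreases from 1 to 0, so the infimum is over a nonempty set
  bounded below; it is right continuous, so the infimum is attained. Almost every later fact on
  rearrangements is read off from this equivalence.\<close>

lemma (in prob_space) rearrangement_le_iff:
  assumes u: "u \<in> borel_measurable M" and s: "0 < s" "s < 1"
  shows "rearrangement M u s \<le> \<tau> \<longleftrightarrow> measure M {x \<in> space M. u x > \<tau>} \<le> s"
proof -
  let ?d = "\<lambda>t. measure M {x \<in> space M. u x > t}"
  let ?S = "{t. ?d t \<le> s}"
  have meas: "{x \<in> space M. u x > t} \<in> sets M" for t using u by measurable
  have anti: "?d t' \<le> ?d t" if "t \<le> t'" for t t'
    using that meas by (intro finite_measure_mono) auto
  have lim0: "(\<lambda>n. ?d (real n)) \<longlonglongrightarrow> measure M (\<Inter>n. {x \<in> space M. u x > real n})"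
    using meas by (intro finite_Lim_measure_decseq) (auto simp: decseq_def)
  have e: "(\<Inter>n. {x \<in> space M. u x > real n}) = {}"
  proof -
    have "\<exists>n. \<not> u x > real n" for x using real_arch_simple[of "u x"] by (auto simp: not_less)
    then show ?thesis by blast
  qed
  have "\<exists>n. ?d (real n) < s"
    using order_tendstoD(2)[OF lim0, of s] s e by (auto simp: eventually_sequentially)
  then obtain t0 where t0: "?d t0 < s" by blast
  have lim1: "(\<lambda>n. ?d (- real n)) \<longlonglongrightarrow> measure M (\<Union>n. {x \<in> space M. u x > - real n})"
    using meas by (intro finite_Lim_measure_incseq) (auto simp: incseq_def)
  have "(\<Union>n. {x \<in> space M. u x > - real n}) = space M"
  proof -
    have "\<exists>n. u x > - real n" for x using reals_Archimedean2[of "- u x"] by (metis minus_less_iff)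
    then show ?thesis by blast
  qed
  then have "\<exists>n. ?d (- real n) > s"
    using order_tendstoD(1)[OF lim1, of s] s prob_space by (auto simp: eventually_sequentially)
  then obtain t1 where t1: "?d t1 > s" by blast
  have bdd: "bdd_below ?S"
  proof (rule bdd_belowI)
    fix t assume "t \<in> ?S"
    then show "t1 \<le> t" using anti[of t t1] t1 by (cases "t \<le> t1") auto
  qed
  have ne: "?S \<noteq> {}" using t0 by (auto intro: less_imp_le)
  have up: "?d t \<le> s" if "Inf ?S < t" for t
  proof -
    obtain r where "r \<in> ?S" "r < t" using cInf_lessD[OF ne \<open>Inf ?S < t\<close>] by blast
    then show ?thesis using anti[of r t] by simp
  qed
  have att: "?d (Inf ?S) \<le> s"
  proof -
    have l: "(\<lambda>n. ?d (Inf ?S + inverse (real (Suc n)))) \<longlonglongrightarrow>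
       measure M (\<Union>n. {x \<in> space M. u x > Inf ?S + inverse (real (Suc n))})"
    proof (rule finite_Lim_measure_incseq)
      show "incseq (\<lambda>n. {x \<in> space M. u x > Inf ?S + inverse (real (Suc n))})"
        unfolding incseq_def using inverse_Suc_le by (smt (verit) Collect_mono)
    qed (use meas in auto)
    have "(\<Union>n. {x \<in> space M. u x > Inf ?S + inverse (real (Suc n))}) = {x \<in> space M. u x > Inf ?S}" (is "?A = ?B")
    proof
      show "?A \<subseteq> ?B"
      proof
        fix x assume "x \<in> ?A"
        then obtain n where "x \<in> space M" and n: "u x > Inf ?S + inverse (real (Suc n))" by blast
        moreover have "inverse (real (Suc n)) > 0" by simp
        ultimately show "x \<in> ?B" by (smt (verit) mem_Collect_eq)
      qed
      show "?B \<subseteq> ?A"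
      proof
        fix x assume x: "x \<in> ?B"
        then obtain n where "inverse (real (Suc n)) < u x - Inf ?S"
          using reals_Archimedean[of "u x - Inf ?S"] by auto
        then show "x \<in> ?A" using x by (auto intro!: exI[of _ n])
      qed
    qed
    then show ?thesis using LIMSEQ_le_const2[OF l, of s] up by auto
  qed
  show ?thesis unfolding rearrangement_def
  proof
    assume "Inf ?S \<le> \<tau>" then show "?d \<tau> \<le> s" using anti[of "Inf ?S" \<tau>] att by simp
  next
    assume "?d \<tau> \<le> s" then show "Inf ?S \<le> \<tau>" by (intro cInf_lower bdd) simp
  qed
qed

lemma (in prob_space) rearrangement_antimono:
  assumes "u \<in> borel_measurable M" "0 < s" "s \<le> t" "t < 1"
  shows "rearrangement M u t \<le> rearrangement M u s"
  using rearrangement_le_iff[of u t "rearrangement M u s"] rearrangement_le_iff[of u s "rearrangement M u s"] assms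
  by auto

text \<open>The set is the decreasing intersection of the sets where
  \<open>u > R s - 1 / (n + 1)\<close>, each of measure greater than \<open>s\<close>. Together with
  \<open>rearrangement_le_iff\<close> this bounds the measure of the shells between two values of
  the rearrangement.\<close>

lemma (in prob_space) measure_ge_rearrangement:
  assumes u: "u \<in> borel_measurable M" and s: "0 < s" "s < 1"
  shows "s \<le> measure M {x \<in> space M. rearrangement M u s \<le> u x}"
proof -
  let ?r = "rearrangement M u s"
  have meas: "{x \<in> space M. u x > t} \<in> sets M" for t using u by measurable
  have l: "(\<lambda>n. measure M {x \<in> space M. u x > ?r - inverse (real (Suc n))}) \<longlonglongrightarrow>
       measure M (\<Inter>n. {x \<in> space M. u x > ?r - inverse (real (Suc n))})"
  proof (rule finite_Lim_measure_decseq)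
    show "decseq (\<lambda>n. {x \<in> space M. u x > ?r - inverse (real (Suc n))})"
      unfolding decseq_def using inverse_Suc_le by (smt (verit) Collect_mono)
  qed (use meas in auto)
  have "(\<Inter>n. {x \<in> space M. u x > ?r - inverse (real (Suc n))}) = {x \<in> space M. ?r \<le> u x}" (is "?A = ?B")
  proof
    show "?A \<subseteq> ?B"
    proof
      fix x assume x: "x \<in> ?A"
      have "?r \<le> u x"
      proof (rule ccontr)
        assume "\<not> ?r \<le> u x"
        then obtain n where "inverse (real (Suc n)) < ?r - u x"
          using reals_Archimedean[of "?r - u x"] by auto
        moreover have "u x > ?r - inverse (real (Suc n))" using x by blast
        ultimately show False by simp
      qed
      then show "x \<in> ?B" using x by auto
    qed
    show "?B \<subseteq> ?A"
    proof
      fix x assume x: "x \<in> ?B"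
      have "?r - inverse (real (Suc n)) < u x" for n
        using x inverse_positive_iff_positive[of "real (Suc n)"] by (smt (verit) mem_Collect_eq of_nat_0_less_iff zero_less_Suc)
      then show "x \<in> ?A" using x by auto
    qed
  qed
  moreover have "measure M {x \<in> space M. u x > ?r - inverse (real (Suc n))} \<ge> s" for n
  proof -
    have "\<not> ?r \<le> ?r - inverse (real (Suc n))" by simp
    then show ?thesis using rearrangement_le_iff[OF u s, of "?r - inverse (real (Suc n))"] by linarith
  qed
  ultimately show ?thesis using LIMSEQ_le_const[OF l, of s] by auto
qed

text \<open>\<open>\<tau> < R s\<close> means that \<open>s\<close> is strictly below the measure of
  the set where \<open>u > \<tau>\<close>, a condition that survives a small increase of
  \<open>s\<close>. The other half is monotonicity.\<close>

lemma (in prob_space) rearrangement_right_continuous: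
  assumes u: "u \<in> borel_measurable M" and s: "0 < s" "s < 1"
    and h: "h \<longlonglongrightarrow> 0" "\<And>n::nat. 0 < h n"
  shows "(\<lambda>n. rearrangement M u (s + h n)) \<longlonglongrightarrow> rearrangement M u s"
proof (rule order_tendstoI)
  have lim: "(\<lambda>n. s + h n) \<longlonglongrightarrow> s + 0" by (intro tendsto_intros h)
  fix \<tau> assume t: "\<tau> < rearrangement M u s"
  then have "s < measure M {x \<in> space M. u x > \<tau>}" using rearrangement_le_iff[OF u s, of \<tau>] by linarith
  then have "\<forall>\<^sub>F n in sequentially. s + h n < measure M {x \<in> space M. u x > \<tau>}"
    using order_tendstoD(2)[OF lim] by auto
  moreover have "\<forall>\<^sub>F n in sequentially. s + h n < 1" using order_tendstoD(2)[OF lim] s by auto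
  ultimately show "\<forall>\<^sub>F n in sequentially. \<tau> < rearrangement M u (s + h n)"
  proof eventually_elim
    case (elim n)
    then show ?case using rearrangement_le_iff[OF u, of "s + h n" \<tau>] s h(2)[of n] by linarith
  qed
next
  have lim: "(\<lambda>n. s + h n) \<longlonglongrightarrow> s + 0" by (intro tendsto_intros h)
  fix \<tau> assume t: "rearrangement M u s < \<tau>"
  have "\<forall>\<^sub>F n in sequentially. s + h n < 1" using order_tendstoD(2)[OF lim] s by auto
  then show "\<forall>\<^sub>F n in sequentially. rearrangement M u (s + h n) < \<tau>"
  proof eventually_elim
    case (elim n)
    then show ?case using rearrangement_antimono[OF u, of s "s + h n"] s h(2)[of n] t by linarith
  qed
qed

text \<open>Both sides are iterated integrals of one indicator function. The exchange of level and
  point serves the layer cake formula and the coarea inequality alike.\<close>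

lemma (in sigma_finite_measure) nn_integral_emeasure_swap:
  assumes P: "Measurable.pred (lborel \<Otimes>\<^sub>M M) (\<lambda>(\<tau>::real, x). P \<tau> x)"
  shows "(\<integral>\<^sup>+\<tau>. emeasure M {x \<in> space M. P \<tau> x} \<partial>lborel) = (\<integral>\<^sup>+x. emeasure lborel {\<tau>. P \<tau> x} \<partial>M)"
proof -
  interpret pair_sigma_finite lborel M ..
  define F where "F = (\<lambda>(\<tau>::real, x). indicator {z \<in> space (lborel \<Otimes>\<^sub>M M). case z of (\<tau>, x) \<Rightarrow> P \<tau> x} (\<tau>, x) :: ennreal)"
  have F: "F \<in> borel_measurable (lborel \<Otimes>\<^sub>M M)"
    unfolding F_def case_prod_eta using P by (intro borel_measurable_indicator) (simp add: pred_def)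
  have Feq: "F (\<tau>, x) = indicator {x \<in> space M. P \<tau> x} x" for \<tau> x
    by (auto simp: F_def space_pair_measure split: split_indicator)
  have 1: "(\<integral>\<^sup>+x. F (\<tau>, x) \<partial>M) = emeasure M {x \<in> space M. P \<tau> x}" for \<tau>
  proof -
    have "{x \<in> space M. P \<tau> x} \<in> sets M"
      using measurable_compose[OF measurable_Pair1'[of \<tau> lborel M] P] by (simp add: pred_def)
    then show ?thesis unfolding Feq by (rule nn_integral_indicator)
  qed
  have 2: "(\<integral>\<^sup>+\<tau>. F (\<tau>, x) \<partial>lborel) = emeasure lborel {\<tau>. P \<tau> x}" if x: "x \<in> space M" for x
  proof -
    have "{\<tau>. P \<tau> x} \<in> sets lborel"
      using measurable_compose[OF measurable_Pair2'[OF x, of lborel] P] by (simp add: pred_def)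
    then have "(\<integral>\<^sup>+\<tau>. indicator {\<tau>. P \<tau> x} \<tau> \<partial>lborel) = emeasure lborel {\<tau>. P \<tau> x}" by (rule nn_integral_indicator)
    moreover have "F (\<tau>, x) = indicator {\<tau>. P \<tau> x} \<tau>" for \<tau> using x by (auto simp: Feq split: split_indicator)
    ultimately show ?thesis by simp
  qed
  have "(\<integral>\<^sup>+x. \<integral>\<^sup>+\<tau>. F (\<tau>, x) \<partial>lborel \<partial>M) = (\<integral>\<^sup>+\<tau>. \<integral>\<^sup>+x. F (\<tau>, x) \<partial>M \<partial>lborel)"
    using F by (rule Fubini)
  then show ?thesis using 2 by (simp add: 1 cong: nn_integral_cong)
qed

text \<open>Since \<open>ennreal\<close> sends negative reals to 0, the left side integrates the
  positive part, which is why only levels \<open>0 < \<tau>\<close> occur.\<close>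

lemma (in sigma_finite_measure) layer_cake:
  assumes [measurable]: "w \<in> borel_measurable M"
  shows "(\<integral>\<^sup>+x. ennreal (w x) \<partial>M) = (\<integral>\<^sup>+\<tau>. emeasure M {x \<in> space M. 0 < \<tau> \<and> \<tau> < w x} \<partial>lborel)"
proof -
  have "ennreal (w x) = emeasure lborel {\<tau>. 0 < \<tau> \<and> \<tau> < w x}" for x
  proof -
    have "{\<tau>. 0 < \<tau> \<and> \<tau> < w x} = {0<..<w x}" by auto
    moreover have "ennreal (w x) = emeasure lborel {0<..<w x}"
      by (cases "0 \<le> w x") (auto simp: ennreal_neg)
    ultimately show ?thesis by simp
  qed
  then show ?thesis by (subst nn_integral_emeasure_swap) auto
qed

lemma nn_integral_restrict_eq:
  fixes w :: "'a \<Rightarrow> real"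
  assumes E: "E \<in> sets M"
  shows "(\<integral>\<^sup>+x\<in>E. ennreal (w x) \<partial>M) = (\<integral>\<^sup>+x. ennreal (w x * indicator E x) \<partial>M)"
  by (intro nn_integral_cong) (auto split: split_indicator)

text \<open>Level by level: the part of \<open>E\<close> where \<open>v > \<tau>\<close> has measure
  at most the minimum of \<open>t\<close> and the measure of the whole superlevel set, and this
  minimum is exactly the length of the set of \<open>s\<close> in \<open>(0, t)\<close> where the
  rearrangement exceeds \<open>\<tau>\<close>.\<close>

lemma (in prob_space) hardy_littlewood_rearrangement:
  assumes v[measurable]: "v \<in> borel_measurable M" and E[measurable]: "E \<in> sets M"
    and t: "measure M E \<le> t" "t \<le> 1"
  shows "(\<integral>\<^sup>+x\<in>E. ennreal (v x) \<partial>M) \<le> (\<integral>\<^sup>+s\<in>{0<..<t}. ennreal (rearrangement M v s) \<partial>lborel)"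
proof -
  let ?V = "\<lambda>s. rearrangement M v s * indicator {0<..<t} s"
  have m: "?V \<in> borel_measurable borel"
  proof -
    have "mono_on {0<..<t} (\<lambda>s. - rearrangement M v s)"
      using t by (auto intro!: mono_onI rearrangement_antimono[OF v])
    then have "(\<lambda>s. - rearrangement M v s) \<in> borel_measurable (restrict_space borel {0<..<t})"
      by (rule borel_measurable_mono_on_fnc)
    then have "(\<lambda>s. - (- rearrangement M v s)) \<in> borel_measurable (restrict_space borel {0<..<t})"
      by (rule borel_measurable_uminus)
    then have "rearrangement M v \<in> borel_measurable (restrict_space borel {0<..<t})" by simp
    then show ?thesis by (subst (asm) borel_measurable_restrict_space_iff) (auto simp: mult.commute)
  qed
  have "(\<integral>\<^sup>+x\<in>E. ennreal (v x) \<partial>M) = (\<integral>\<^sup>+x. ennreal (v x * indicator E x) \<partial>M)"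
    by (rule nn_integral_restrict_eq) fact
  also have "\<dots> = (\<integral>\<^sup>+\<tau>. emeasure M {x \<in> space M. 0 < \<tau> \<and> \<tau> < v x * indicator E x} \<partial>lborel)"
    by (intro layer_cake) measurable
  also have "\<dots> \<le> (\<integral>\<^sup>+\<tau>. emeasure lborel {s \<in> space lborel. 0 < \<tau> \<and> \<tau> < ?V s} \<partial>lborel)"
  proof (intro nn_integral_mono)
    fix \<tau> :: real
    show "emeasure M {x \<in> space M. 0 < \<tau> \<and> \<tau> < v x * indicator E x} \<le>
          emeasure lborel {s \<in> space lborel. 0 < \<tau> \<and> \<tau> < ?V s}"
    proof (cases "0 < \<tau>")
      case True
      let ?c = "measure M {x \<in> space M. v x > \<tau>}"
      have "{s \<in> space lborel. 0 < \<tau> \<and> \<tau> < ?V s} = {0<..<min t ?c}"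
      proof (intro set_eqI)
        fix s
        show "s \<in> {s \<in> space lborel. 0 < \<tau> \<and> \<tau> < ?V s} \<longleftrightarrow> s \<in> {0<..<min t ?c}"
          using True t rearrangement_le_iff[OF v, of s \<tau>] by (cases "s \<in> {0<..<t}") auto
      qed
      moreover have "0 \<le> min t ?c" 
        using t measure_nonneg[of M E] measure_nonneg[of M "{x \<in> space M. v x > \<tau>}"] by linarith
      ultimately have r: "emeasure lborel {s \<in> space lborel. 0 < \<tau> \<and> \<tau> < ?V s} = ennreal (min t ?c)" by simp
      have l: "{x \<in> space M. 0 < \<tau> \<and> \<tau> < v x * indicator E x} = E \<inter> {x \<in> space M. v x > \<tau>}"
        using True sets.sets_into_space[OF E] by (auto split: split_indicator_asm)
      have "measure M (E \<inter> {x \<in> space M. v x > \<tau>}) \<le> min t ?c"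
      proof -
        have "measure M (E \<inter> {x \<in> space M. v x > \<tau>}) \<le> measure M E" by (intro finite_measure_mono) auto
        moreover have "measure M (E \<inter> {x \<in> space M. v x > \<tau>}) \<le> ?c" by (intro finite_measure_mono) auto
        ultimately show ?thesis using t by simp
      qed
      then show ?thesis unfolding l r emeasure_eq_measure by (rule ennreal_leI)
    qed simp
  qed
  also have "\<dots> = (\<integral>\<^sup>+s. ennreal (?V s) \<partial>lborel)"
    using m by (intro sigma_finite_measure.layer_cake[symmetric] sigma_finite_lborel) simp
  also have "\<dots> = (\<integral>\<^sup>+s\<in>{0<..<t}. ennreal (rearrangement M v s) \<partial>lborel)"
    by (intro nn_integral_cong) (auto split: split_indicator)
  finally show ?thesis .
qed

section \<open>A coarea inequality\<close>

text \<open>For fixed radius the supremum of the quotients over the punctured ball is lower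
  semicontinuous in the centre: the second point \<open>z\<close> stays admissible when
  \<open>x\<close> moves a little. The suprema increase with the radius, so countably many radii
  give the upper limit.\<close>

lemma borel_measurable_grad_modulus:
  fixes f :: "'a::metric_space \<Rightarrow> real"
  assumes f: "continuous_on UNIV f"
  shows "grad_modulus f \<in> borel_measurable borel"
proof -
  define q where "q x y = ennreal (\<bar>f x - f y\<bar> / dist x y)" for x y
  define S where "S e x = (SUP y\<in>ball x e - {x}. q x y)" for e x
  have S: "S e \<in> borel_measurable borel" for e
  proof (rule borel_measurableI_greater)
    fix c
    have "open ((\<lambda>x. q x z) -` {c<..} \<inter> (ball z e - {z}))" for z
    proof -
      have "continuous_on (ball z e - {z}) (\<lambda>x. q x z)"
        unfolding q_def by (intro continuous_on_ennreal continuous_intros continuous_on_subset[OF f]) auto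
      then show ?thesis
        by (subst (asm) continuous_on_open_vimage) (auto intro!: open_Diff)
    qed
    moreover have "{x. c < S e x} = (\<Union>z. (\<lambda>x. q x z) -` {c<..} \<inter> (ball z e - {z}))"
      by (auto simp: S_def less_SUP_iff dist_commute)
    ultimately have "open {x. c < S e x}" by auto
    then show "{x \<in> space borel. c < S e x} \<in> sets borel" by simp
  qed
  have "Limsup (at x) (q x) = (INF n. S (inverse (real (Suc n))) x)" for x
  proof -
    have "Limsup (at x) (q x) = (INF e\<in>{0<..}. S e x)"
      unfolding S_def by (simp add: Limsup_within)
    also have "\<dots> = (INF n. S (inverse (real (Suc n))) x)"
    proof (rule INF_eq)
      fix e :: real assume "e \<in> {0<..}"
      then obtain n where "inverse (real (Suc n)) < e" using reals_Archimedean by auto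
      then have "S (inverse (real (Suc n))) x \<le> S e x"
        unfolding S_def by (intro SUP_subset_mono) auto
      then show "\<exists>n\<in>UNIV. S (inverse (real (Suc n))) x \<le> S e x" by blast
    next
      fix n
      show "\<exists>e\<in>{0<..}. S e x \<le> S (inverse (real (Suc n))) x"
        by (intro bexI[of _ "inverse (real (Suc n))"]) auto
    qed
    finally show ?thesis .
  qed
  then have "grad_modulus f = (\<lambda>x. enn2real (INF n. S (inverse (real (Suc n))) x))"
    unfolding grad_modulus_def q_def by auto
  also have "\<dots> \<in> borel_measurable borel" using S by measurable
  finally show ?thesis .
qed

lemma ennreal_grad_modulus:
  fixes f :: "'a::metric_space \<Rightarrow> real"
  assumes "L-lipschitz_on UNIV f"
  shows "ennreal (grad_modulus f x) = Limsup (at x) (\<lambda>y. ennreal (\<bar>f x - f y\<bar> / dist x y))" (is ?A)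
    and "grad_modulus f x \<le> L" (is ?B)
proof -
  have L: "0 \<le> L" using assms by (rule lipschitz_on_nonneg)
  have "Limsup (at x) (\<lambda>y. ennreal (\<bar>f x - f y\<bar> / dist x y)) \<le> ennreal L"
  proof (rule Limsup_bounded)
    show "\<forall>\<^sub>F y in at x. ennreal (\<bar>f x - f y\<bar> / dist x y) \<le> ennreal L"
      using L lipschitz_onD[OF assms, of x]
      by (auto simp: eventually_at dist_real_def divide_simps intro!: exI[of _ 1] ennreal_leI)
  qed
  then show ?A ?B unfolding grad_modulus_def
    using L by (auto simp: ennreal_enn2real_if enn2real_leI top_unique)
qed

lemma grad_modulus_nonneg: "0 \<le> grad_modulus f x"
  by (simp add: grad_modulus_def)

text \<open>Its superlevel sets are the enlargements of those of \<open>f\<close>. The difference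
  quotients defining the perimeter thereby turn into difference quotients of functions.\<close>

definition ball_sup :: "('a::metric_space \<Rightarrow> real) \<Rightarrow> real \<Rightarrow> 'a \<Rightarrow> real" where
  "ball_sup f h x = (SUP y\<in>ball x h. f y)"

lemma bdd_above_ball_image:
  fixes f :: "'a::metric_space \<Rightarrow> real"
  assumes "L-lipschitz_on UNIV f"
  shows "bdd_above (f ` ball x h)"
proof (rule bdd_aboveI2)
  fix y assume "y \<in> ball x h"
  then have "L * dist x y \<le> L * h" using lipschitz_on_nonneg[OF assms] by (intro mult_left_mono) auto
  moreover have "\<bar>f x - f y\<bar> \<le> L * dist x y" using lipschitz_onD[OF assms, of x y] by (simp add: dist_real_def)
  ultimately show "f y \<le> f x + L * h" by linarith
qed

lemma less_ball_sup_iff: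
  fixes f :: "'a::metric_space \<Rightarrow> real"
  assumes "L-lipschitz_on UNIV f" "0 < h"
  shows "\<tau> < ball_sup f h x \<longleftrightarrow> (\<exists>y\<in>ball x h. \<tau> < f y)"
  unfolding ball_sup_def using assms bdd_above_ball_image[OF assms(1), of x h]
  by (subst less_cSUP_iff) auto

text \<open>A point has distance less than \<open>h\<close> from a nonempty set iff its open
  \<open>h\<close>-ball meets the set. If no value exceeds \<open>\<tau>\<close>, both sides are
  empty, thanks to the clause on \<open>{}\<close> in \<open>enlargement\<close>.\<close>

lemma enlargement_superlevel:
  fixes f :: "'a::metric_space \<Rightarrow> real"
  assumes "L-lipschitz_on UNIV f" "0 < h"
  shows "enlargement {x. \<tau> < f x} h = {x. \<tau> < ball_sup f h x}"
proof -
  have "enlargement A h = {x. \<exists>y\<in>ball x h. y \<in> A}" for A :: "'a set"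
    unfolding enlargement_def
    by (cases "A = {}") (auto simp: infdist_notempty cINF_less_iff bdd_belowI2[of _ 0])
  then show ?thesis using less_ball_sup_iff[OF assms] by auto
qed

lemma ball_sup_ge:
  fixes f :: "'a::metric_space \<Rightarrow> real"
  assumes "L-lipschitz_on UNIV f" "0 < h"
  shows "f x \<le> ball_sup f h x"
  unfolding ball_sup_def using assms by (intro cSUP_upper bdd_above_ball_image) auto

lemma ball_sup_le:
  fixes f :: "'a::metric_space \<Rightarrow> real"
  assumes "0 < h" "0 \<le> c" "\<And>y. y \<in> ball x h \<Longrightarrow> \<bar>f x - f y\<bar> \<le> c * dist x y"
  shows "ball_sup f h x \<le> f x + c * h"
  unfolding ball_sup_def
proof (rule cSUP_least)
  fix y assume y: "y \<in> ball x h"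
  then have "c * dist x y \<le> c * h" using assms by (intro mult_left_mono) auto
  then show "f y \<le> f x + c * h" using assms(3)[OF y] by linarith
qed (use assms in auto)

lemma borel_measurable_ball_sup:
  fixes f :: "'a::metric_space \<Rightarrow> real"
  assumes f: "L-lipschitz_on UNIV f" and h: "0 < h"
  shows "ball_sup f h \<in> borel_measurable borel"
proof (rule borel_measurableI_greater)
  fix c
  have "{x. c < ball_sup f h x} = (\<Union>y\<in>{y. c < f y}. ball y h)"
    using less_ball_sup_iff[OF f h] by (auto simp: dist_commute)
  then have "open {x. c < ball_sup f h x}" by auto
  then show "{x \<in> space borel. c < ball_sup f h x} \<in> sets borel" by simp
qed

text \<open>Below level \<open>a\<close> the supremum over a small ball stays below
  \<open>a\<close>, and from level \<open>b\<close> on the numerator is never positive. The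
  asymmetry between \<open>a\<close> and \<open>b\<close> arises because \<open>ball_sup\<close>
  looks only upward: points at level \<open>a\<close> may contribute, points at level
  \<open>b\<close> cannot.\<close>

lemma limsup_truncated_quotient:
  fixes f :: "'a::metric_space \<Rightarrow> real"
  assumes f: "L-lipschitz_on UNIV f" and h: "h \<longlonglongrightarrow> 0" "\<And>n::nat. 0 < h n"
  shows "limsup (\<lambda>n. ennreal ((min b (ball_sup f (h n) x) - max a (f x)) / h n))
          \<le> ennreal (grad_modulus f x) * indicator {x. a \<le> f x \<and> f x < b} x"
proof -
  have L: "0 \<le> L" using f by (rule lipschitz_on_nonneg)
  have lip: "\<bar>f x - f y\<bar> \<le> L * dist x y" for y
    using lipschitz_onD[OF f, of x y] by (simp add: dist_real_def)
  consider "f x < a" | "b \<le> f x" | "a \<le> f x" "f x < b" by linarith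
  then show ?thesis
  proof cases
    case 1
    have "(\<lambda>n. f x + L * h n) \<longlonglongrightarrow> f x + L * 0" by (intro tendsto_intros h)
    then have "\<forall>\<^sub>F n in sequentially. f x + L * h n < a" using 1 order_tendstoD(2) by fastforce
    then have "\<forall>\<^sub>F n in sequentially. ennreal ((min b (ball_sup f (h n) x) - max a (f x)) / h n) \<le> 0"
    proof eventually_elim
      case (elim n)
      have "ball_sup f (h n) x \<le> f x + L * h n" using ball_sup_le[OF h(2) L lip] .
      then have "(min b (ball_sup f (h n) x) - max a (f x)) / h n \<le> 0" using elim h(2)[of n] 
        by (intro divide_nonpos_pos) auto
      then show ?case by (simp add: ennreal_neg)
    qed
    then have "limsup (\<lambda>n. ennreal ((min b (ball_sup f (h n) x) - max a (f x)) / h n)) \<le> 0"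
      by (rule Limsup_bounded)
    then show ?thesis by (rule order_trans) simp
  next
    case 2
    have "(min b (ball_sup f (h n) x) - max a (f x)) / h n \<le> 0" for n
      using 2 h(2)[of n] by (intro divide_nonpos_pos) auto
    then have "limsup (\<lambda>n. ennreal ((min b (ball_sup f (h n) x) - max a (f x)) / h n)) \<le> 0"
      by (intro Limsup_bounded always_eventually allI) (simp add: ennreal_neg)
    then show ?thesis by (rule order_trans) simp
  next
    case 3
    have "limsup (\<lambda>n. ennreal ((min b (ball_sup f (h n) x) - max a (f x)) / h n)) \<le> ennreal (grad_modulus f x)"
    proof (rule ennreal_le_epsilon)
      fix e :: real assume e: "0 < e"
      let ?g = "grad_modulus f x"
      have "Limsup (at x) (\<lambda>y. ennreal (\<bar>f x - f y\<bar> / dist x y)) < ennreal (?g + e)"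
        unfolding ennreal_grad_modulus(1)[OF f, symmetric] using e grad_modulus_nonneg[of f x] 
        by (simp add: ennreal_less_iff)
      from Limsup_lessD[OF this]
      obtain d where d: "0 < d" "\<And>y. y \<noteq> x \<Longrightarrow> dist y x < d \<Longrightarrow> ennreal (\<bar>f x - f y\<bar> / dist x y) < ennreal (?g + e)"
        unfolding eventually_at by auto
      have d': "\<bar>f x - f y\<bar> \<le> (?g + e) * dist x y" if "dist x y < d" for y
      proof (cases "y = x")
        case False
        then have "\<bar>f x - f y\<bar> / dist x y < ?g + e" using d(2)[of y] that
          by (simp add: dist_commute ennreal_less_iff)
        then show ?thesis using False by (simp add: field_simps)
      qed simp
      have "\<forall>\<^sub>F n in sequentially. h n < d" using order_tendstoD(2)[OF h(1) d(1)] .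
      then have "\<forall>\<^sub>F n in sequentially. ennreal ((min b (ball_sup f (h n) x) - max a (f x)) / h n) \<le> ennreal (?g + e)"
      proof eventually_elim
        case (elim n)
        have "ball_sup f (h n) x \<le> f x + (?g + e) * h n"
          using e grad_modulus_nonneg[of f x] d' elim by (intro ball_sup_le h) auto
        then show ?case using h(2)[of n] 3 by (intro ennreal_leI) (auto simp: field_simps)
      qed
      then have "limsup (\<lambda>n. ennreal ((min b (ball_sup f (h n) x) - max a (f x)) / h n)) \<le> ennreal (?g + e)"
        by (rule Limsup_bounded)
      then show "limsup (\<lambda>n. ennreal ((min b (ball_sup f (h n) x) - max a (f x)) / h n)) \<le> ennreal ?g + ennreal e"
        using e grad_modulus_nonneg[of f x] by simp
    qed
    then show ?thesis using 3 by simp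
  qed
qed

text \<open>Passing to a sequence can only raise the lower limit; a sequence is what Fatou's lemma
  takes.\<close>

lemma perimeter_le_liminf:
  assumes "h \<longlonglongrightarrow> 0" "\<And>n::nat. 0 < h n"
  shows "perimeter M A \<le> liminf (\<lambda>n. ennreal ((measure M (enlargement A (h n)) - measure M A) / h n))"
proof -
  let ?q = "\<lambda>h. ennreal ((measure M (enlargement A h) - measure M A) / h)"
  have "filterlim h (at_right 0) sequentially"
    using assms by (simp add: filterlim_at less_imp_neq[symmetric] always_eventually)
  then have "filtermap h sequentially \<le> at_right 0" by (simp add: filterlim_def)
  then have "perimeter M A \<le> Liminf (filtermap h sequentially) ?q"
    unfolding perimeter_def Liminf_def by (intro SUP_subset_mono) (auto simp: le_filter_def)
  also have "\<dots> \<le> liminf (\<lambda>n. ?q (h n))" by (rule Liminf_filtermap_le)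
  finally show ?thesis .
qed

text \<open>The perimeter bound is integrated over the levels in \<open>(a, b)\<close>. Fatou's
  lemma in \<open>\<tau>\<close> takes the lower limit outside, Fubini turns the quotients into
  functions of \<open>x\<close>, and the reverse Fatou lemma, with the Lipschitz constant as
  integrable majorant, takes the upper limit inside again.\<close>

lemma coarea_lower_bound:
  fixes M :: "'a::metric_space measure"
  assumes P: "prob_space M" and M: "sets M = sets borel" and f: "L-lipschitz_on UNIV f"
    and c: "0 \<le> c" "a \<le> b" "\<And>\<tau>. a < \<tau> \<Longrightarrow> \<tau> < b \<Longrightarrow> ennreal c \<le> perimeter M {x. \<tau> < f x}"
  shows "ennreal (c * (b - a)) \<le> (\<integral>\<^sup>+x\<in>{x. a \<le> f x \<and> f x < b}. ennreal (grad_modulus f x) \<partial>M)"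
proof -
  interpret prob_space M by fact
  have sp[simp]: "space M = UNIV" using sets_eq_imp_space_eq[OF M] by simp
  have L: "0 \<le> L" using f by (rule lipschitz_on_nonneg)
  have lip: "\<bar>f x - f y\<bar> \<le> L * dist x y" for x y
    using lipschitz_onD[OF f, of x y] by (simp add: dist_real_def)
  have meq: "measurable M N = measurable borel N" for N :: "'c measure" using M by (rule measurable_cong_sets) simp
  have cf: "continuous_on UNIV f" using f by (rule lipschitz_on_continuous_on)
  have fm[measurable]: "f \<in> borel_measurable M"
    using cf unfolding meq by (rule borel_measurable_continuous_onI)
  define h where "h n = inverse (real (Suc n))" for n
  have h: "h \<longlonglongrightarrow> 0" "0 < h n" for n unfolding h_def by (rule LIMSEQ_inverse_real_of_nat) simp
  have um[measurable]: "ball_sup f (h n) \<in> borel_measurable M" for n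
    unfolding meq using f h(2) by (rule borel_measurable_ball_sup)
  let ?W = "\<lambda>n x. ennreal ((min b (ball_sup f (h n) x) - max a (f x)) / h n)"
  let ?D = "\<lambda>n \<tau>. emeasure M {x \<in> space M. a < \<tau> \<and> \<tau> < b \<and> f x \<le> \<tau> \<and> \<tau> < ball_sup f (h n) x}"
  have Dm: "?D n \<in> borel_measurable borel" for n
  proof -
    have "(\<lambda>\<tau>. emeasure M (Pair \<tau> -` {z \<in> space (lborel \<Otimes>\<^sub>M M).
        a < fst z \<and> fst z < b \<and> f (snd z) \<le> fst z \<and> fst z < ball_sup f (h n) (snd z)})) \<in> borel_measurable lborel"
      by (rule measurable_emeasure_Pair) measurable
    then show ?thesis by (simp add: space_pair_measure vimage_def)
  qed
  have q: "ennreal ((measure M (enlargement {x. \<tau> < f x} (h n)) - measure M {x. \<tau> < f x}) / h n)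
     = ?D n \<tau> * ennreal (inverse (h n))" if "a < \<tau>" "\<tau> < b" for \<tau> n
  proof -
    have e: "enlargement {x. \<tau> < f x} (h n) = {x. \<tau> < ball_sup f (h n) x}"
      by (rule enlargement_superlevel[OF f h(2)])
    have s: "{x. \<tau> < ball_sup f (h n) x} \<in> sets M" "{x. \<tau> < f x} \<in> sets M"
      using measurable_sets[OF um, of "{\<tau><..}" n] measurable_sets[OF fm, of "{\<tau><..}"] by (auto simp: vimage_def)
    have "measure M {x. \<tau> < ball_sup f (h n) x} - measure M {x. \<tau> < f x} =
      measure M ({x. \<tau> < ball_sup f (h n) x} - {x. \<tau> < f x})"
      using s ball_sup_ge[OF f h(2)] by (intro finite_measure_Diff[symmetric]) (auto intro: less_le_trans)
    also have "{x. \<tau> < ball_sup f (h n) x} - {x. \<tau> < f x} = 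
       {x \<in> space M. a < \<tau> \<and> \<tau> < b \<and> f x \<le> \<tau> \<and> \<tau> < ball_sup f (h n) x}"
      using that by auto
    finally show ?thesis unfolding e 
      by (simp add: emeasure_eq_measure divide_inverse ennreal_mult h less_imp_le)
  qed
  have DW: "(\<integral>\<^sup>+\<tau>. ?D n \<tau> \<partial>lborel) * ennreal (inverse (h n)) = (\<integral>\<^sup>+x. ?W n x \<partial>M)" for n
  proof -
    \<comment> \<open>The set and the open interval differ at most at \<open>\<tau> = f x\<close>,
      which is null.\<close>
    have l: "emeasure lborel {\<tau>. a < \<tau> \<and> \<tau> < b \<and> f x \<le> \<tau> \<and> \<tau> < ball_sup f (h n) x} =
      ennreal (min b (ball_sup f (h n) x) - max a (f x))" (is "emeasure lborel ?T = ennreal (?r - ?l)") for x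
    proof -
      have "emeasure lborel ?T = emeasure lborel {?l<..<?r}"
      proof (rule emeasure_eq_AE)
        show "AE \<tau> in lborel. \<tau> \<in> ?T \<longleftrightarrow> \<tau> \<in> {?l<..<?r}"
          using AE_lborel_singleton[of "f x"] by eventually_elim auto
      qed measurable
      then show ?thesis by (cases "?l \<le> ?r") (auto simp: ennreal_neg)
    qed
    have "(\<integral>\<^sup>+\<tau>. ?D n \<tau> \<partial>lborel) = (\<integral>\<^sup>+x. ennreal (min b (ball_sup f (h n) x) - max a (f x)) \<partial>M)"
      by (subst nn_integral_emeasure_swap) (measurable, simp only: l)
    then have "(\<integral>\<^sup>+\<tau>. ?D n \<tau> \<partial>lborel) * ennreal (inverse (h n)) = 
      (\<integral>\<^sup>+x. ennreal (min b (ball_sup f (h n) x) - max a (f x)) * ennreal (inverse (h n)) \<partial>M)"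
      by (simp add: nn_integral_multc)
    also have "\<dots> = (\<integral>\<^sup>+x. ?W n x \<partial>M)"
    proof (intro nn_integral_cong)
      fix x
      show "ennreal (min b (ball_sup f (h n) x) - max a (f x)) * ennreal (inverse (h n)) = ?W n x"
        using h(2)[of n] by (simp add: divide_inverse ennreal_mult'')
    qed
    finally show ?thesis .
  qed
  have "ennreal (c * (b - a)) = (\<integral>\<^sup>+\<tau>. ennreal c * indicator {a<..<b} \<tau> \<partial>lborel)"
    using c by (simp add: nn_integral_cmult_indicator ennreal_mult)
  also have "\<dots> \<le> (\<integral>\<^sup>+\<tau>. liminf (\<lambda>n. ?D n \<tau> * ennreal (inverse (h n))) \<partial>lborel)"
  proof (intro nn_integral_mono)
    fix \<tau> :: real
    show "ennreal c * indicator {a<..<b} \<tau> \<le> liminf (\<lambda>n. ?D n \<tau> * ennreal (inverse (h n)))"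
    proof (cases "\<tau> \<in> {a<..<b}")
      case True
      then show ?thesis using c(3)[of \<tau>] perimeter_le_liminf[OF h, of M "{x. \<tau> < f x}"] q[of \<tau>] by simp
    qed simp
  qed
  also have "\<dots> \<le> liminf (\<lambda>n. \<integral>\<^sup>+\<tau>. ?D n \<tau> * ennreal (inverse (h n)) \<partial>lborel)"
    using Dm by (intro nn_integral_liminf) auto
  also have "\<dots> = liminf (\<lambda>n. \<integral>\<^sup>+x. ?W n x \<partial>M)"
    using Dm by (simp add: nn_integral_multc flip: DW)
  also have "\<dots> \<le> limsup (\<lambda>n. \<integral>\<^sup>+x. ?W n x \<partial>M)" by (intro Liminf_le_Limsup) simp
  also have "\<dots> \<le> (\<integral>\<^sup>+x. limsup (\<lambda>n. ?W n x) \<partial>M)"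
  proof (rule nn_integral_limsup[where w = "\<lambda>_. ennreal L"])
    show "AE x in M. ?W n x \<le> ennreal L" for n
    proof (rule AE_I2)
      fix x
      have "ball_sup f (h n) x \<le> f x + L * h n" by (rule ball_sup_le[OF h(2) L lip])
      then show "?W n x \<le> ennreal L" using h(2)[of n] by (intro ennreal_leI) (auto simp: field_simps)
    qed
    show "(\<integral>\<^sup>+x. ennreal L \<partial>M) < \<infinity>" by (simp add: emeasure_eq_measure ennreal_mult_less_top)
  qed auto
  also have "\<dots> \<le> (\<integral>\<^sup>+x\<in>{x. a \<le> f x \<and> f x < b}. ennreal (grad_modulus f x) \<partial>M)"
    by (intro nn_integral_mono limsup_truncated_quotient[OF f h])
  finally show ?thesis .
qed

section \<open>Majorization of step functions\<close>

lemma borel_measurable_unit_measure: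
  "f \<in> borel_measurable borel \<Longrightarrow> f \<in> borel_measurable unit_measure"
  by (intro measurable_restrict_space1 measurable_completion) simp

lemma borel_measurable_unit_measure_antimono:
  fixes V :: "real \<Rightarrow> real"
  assumes "antimono_on {0<..<1} V"
  shows "V \<in> borel_measurable unit_measure"
proof -
  have "mono_on {0<..<1} (\<lambda>s. - V s)" using assms by (auto simp: monotone_on_def)
  then have "(\<lambda>s. - V s) \<in> borel_measurable (restrict_space borel {0<..<1})"
    by (rule borel_measurable_mono_on_fnc)
  then have "(\<lambda>s. - (- V s)) \<in> borel_measurable (restrict_space borel {0<..<1})"
    by (rule borel_measurable_uminus)
  then have "(\<lambda>s. V s * indicator {0<..<1} s) \<in> borel_measurable borel"
    by (subst (asm) borel_measurable_restrict_space_iff) (auto simp: mult.commute)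
  then have "(\<lambda>s. V s * indicator {0<..<1} s) \<in> borel_measurable unit_measure"
    by (rule borel_measurable_unit_measure)
  then show ?thesis by (rule measurable_cong[THEN iffD1, rotated]) (auto simp: space_restrict_space)
qed

lemma AE_unit_measureI:
  assumes "\<And>x. 0 < x \<Longrightarrow> x < 1 \<Longrightarrow> P x"
  shows "AE x in unit_measure. P x"
  using assms by (intro AE_I2) (simp add: space_restrict_space)

text \<open>The norm sees only \<open>(0,1)\<close>, so for \<open>0 < n\<close> only the values
  \<open>a i\<close> with \<open>i < n\<close> count.\<close>

definition step :: "nat \<Rightarrow> (nat \<Rightarrow> real) \<Rightarrow> real \<Rightarrow> real" where
  "step n a x = a (nat \<lfloor>real n * x\<rfloor>)"

lemma borel_measurable_step [measurable]: "step n a \<in> borel_measurable borel"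
  unfolding step_def by measurable

lemma floor_cell:
  assumes "0 < x" "x < 1" "0 < n"
  shows "nat \<lfloor>real n * x\<rfloor> < n" "real (nat \<lfloor>real n * x\<rfloor>) \<le> real n * x" "real n * x < real (nat \<lfloor>real n * x\<rfloor>) + 1"
proof -
  have "0 \<le> real n * x" using assms by simp
  moreover have "real n * x < real n" using assms by simp
  ultimately show "nat \<lfloor>real n * x\<rfloor> < n" "real (nat \<lfloor>real n * x\<rfloor>) \<le> real n * x"
    "real n * x < real (nat \<lfloor>real n * x\<rfloor>) + 1" by linarith+
qed

lemma step_bounded:
  assumes "0 < n" "0 < x" "x < 1"
  shows "\<bar>step n a x\<bar> \<le> (\<Sum>i<n. \<bar>a i\<bar>)"
proof -
  have "nat \<lfloor>real n * x\<rfloor> \<in> {..<n}" using floor_cell(1) assms by simp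
  then show ?thesis
    unfolding step_def using member_le_sum[of _ "{..<n}" "\<lambda>i. \<bar>a i\<bar>"] by simp
qed

text \<open>All cells have the same measure, so the distribution function of a step function is a
  count of indices and is unchanged by permutations.\<close>

lemma measure_step_level:
  assumes n: "0 < n"
  shows "measure unit_measure {x \<in> space unit_measure. P (nat \<lfloor>real n * x\<rfloor>)} = real (card {i. i < n \<and> P i}) / real n"
proof -
  define A where "A i = {x \<in> {0<..<1}. nat \<lfloor>real n * x\<rfloor> = i}" for i
  have Ai: "A i \<in> sets unit_measure \<and> measure unit_measure (A i) = 1 / real n" if i: "i < n" for i
  proof -
    let ?l = "real i / real n" and ?r = "real (i + 1) / real n"
    have lr: "0 \<le> ?l" "?l < ?r" "?r \<le> 1" using i n by (auto simp: field_simps)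
    \<comment> \<open>The point 0 is removed because the unit interval is open; this affects the
      first cell only.\<close>
    have e: "A i = {?l..<?r} - {0}"
    proof (intro set_eqI)
      fix x
      have "nat \<lfloor>real n * x\<rfloor> = i \<longleftrightarrow> ?l \<le> x \<and> x < ?r" if "0 < x"
      proof -
        have "0 \<le> real n * x" using that by simp
        then have "nat \<lfloor>real n * x\<rfloor> = i \<longleftrightarrow> real i \<le> real n * x \<and> real n * x < real i + 1" by linarith
        then show ?thesis using n by (simp add: field_simps)
      qed
      then show "x \<in> A i \<longleftrightarrow> x \<in> {?l..<?r} - {0}"
        using order_trans[OF lr(1), of x] less_le_trans[OF _ lr(3), of x] by (cases "0 < x") (auto simp: A_def simp del: of_nat_add)
    qed
    have s: "A i \<in> sets borel" unfolding e by simp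
    moreover have sub: "A i \<subseteq> {0<..<1}" by (auto simp: A_def)
    ultimately have 1: "A i \<in> sets unit_measure" by (auto simp: sets_restrict_space_iff)
    have "measure unit_measure (A i) = measure lebesgue (A i)"
      using sub by (simp add: measure_restrict_space)
    also have "\<dots> = measure lborel (A i)" using s by simp
    also have "\<dots> = measure lborel {?l..<?r}"
      by (rule measure_eq_AE) (use AE_lborel_singleton[of 0] s in \<open>auto simp: e\<close>)
    also have "\<dots> = ?r - ?l" using lr by (intro measure_lborel_Ico) simp
    also have "\<dots> = 1 / real n" by (simp add: diff_divide_distrib[symmetric])
    finally show ?thesis using 1 by blast
  qed
  let ?I = "{i. i < n \<and> P i}"
  have "{x \<in> space unit_measure. P (nat \<lfloor>real n * x\<rfloor>)} = (\<Union>i\<in>?I. A i)"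
    using floor_cell(1)[OF _ _ n] by (auto simp: A_def space_restrict_space)
  moreover have "finite_measure unit_measure"
    by (intro finite_measureI) (simp add: space_restrict_space emeasure_restrict_space)
  then have "measure unit_measure (\<Union>i\<in>?I. A i) = (\<Sum>i\<in>?I. measure unit_measure (A i))"
    by (rule finite_measure.finite_measure_finite_Union) (use Ai in \<open>auto simp: disjoint_family_on_def A_def\<close>)
  ultimately show ?thesis using Ai by simp
qed

lemma add_mod_eqD:
  fixes p q r m :: nat
  assumes e: "(p + r) mod m = (q + r) mod m" and lt: "p < m" "q < m"
  shows "p = q"
proof -
  have *: "p = q" if "(p + r) mod m = (q + r) mod m" "p < m" "q < m" "p \<le> q" for p q :: nat
  proof -
    have "m dvd (q + r) - (p + r)"
      using that by (subst mod_eq_dvd_iff_nat[symmetric]) auto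
    then have "m dvd q - p" by simp
    moreover have "q - p < m" using that by simp
    ultimately have "q - p = 0" by (metis nat_dvd_not_less gr0I)
    then show ?thesis using that by simp
  qed
  show ?thesis
    using *[of p q] *[of q p] e lt by (cases "p \<le> q") auto
qed

section \<open>Norms of step functions\<close>

locale function_norm =
  fixes N :: "(real \<Rightarrow> real) \<Rightarrow> ennreal"
  assumes banach: "banach_function_norm N"
begin

lemma norm_eq_0: "f \<in> borel_measurable unit_measure \<Longrightarrow> N f = 0 \<longleftrightarrow> (AE x in unit_measure. f x = 0)"
  using banach unfolding banach_function_norm_def by blast

lemma norm_scale: "f \<in> borel_measurable unit_measure \<Longrightarrow> N (\<lambda>x. c * f x) = ennreal \<bar>c\<bar> * N f"
  using banach unfolding banach_function_norm_def by blast

lemma norm_triangle: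
  "f \<in> borel_measurable unit_measure \<Longrightarrow> g \<in> borel_measurable unit_measure \<Longrightarrow> N (\<lambda>x. f x + g x) \<le> N f + N g"
  using banach unfolding banach_function_norm_def by blast

lemma norm_mono_AE:
  "f \<in> borel_measurable unit_measure \<Longrightarrow> g \<in> borel_measurable unit_measure \<Longrightarrow>
   (AE x in unit_measure. \<bar>f x\<bar> \<le> \<bar>g x\<bar>) \<Longrightarrow> N f \<le> N g"
  using banach unfolding banach_function_norm_def by blast

lemma norm_mono:
  "f \<in> borel_measurable unit_measure \<Longrightarrow> g \<in> borel_measurable unit_measure \<Longrightarrow>
   (\<And>x. 0 < x \<Longrightarrow> x < 1 \<Longrightarrow> \<bar>f x\<bar> \<le> \<bar>g x\<bar>) \<Longrightarrow> N f \<le> N g"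
  by (intro norm_mono_AE AE_unit_measureI)

lemma norm_fatou:
  "f \<in> borel_measurable unit_measure \<Longrightarrow> (\<And>n::nat. F n \<in> borel_measurable unit_measure) \<Longrightarrow>
   (AE x in unit_measure. (\<forall>n. 0 \<le> F n x \<and> F n x \<le> F (Suc n) x) \<and> (\<lambda>n. F n x) \<longlonglongrightarrow> f x) \<Longrightarrow>
   (\<lambda>n. N (F n)) \<longlonglongrightarrow> N f"
  using banach unfolding banach_function_norm_def by blast

lemma norm_one: "N (\<lambda>x. 1) < \<infinity>"
  using banach unfolding banach_function_norm_def by blast

lemma norm_const: "N (\<lambda>x. c) = ennreal \<bar>c\<bar> * N (\<lambda>x. 1)"
  using norm_scale[of "\<lambda>x. 1" c] by simp

lemma norm_bounded_finite:
  assumes "f \<in> borel_measurable unit_measure" "\<And>x. 0 < x \<Longrightarrow> x < 1 \<Longrightarrow> \<bar>f x\<bar> \<le> C"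
  shows "N f < \<infinity>"
proof -
  have "N f \<le> N (\<lambda>x. C)" by (intro norm_mono assms) (auto intro: order_trans[OF assms(2) abs_ge_self])
  also have "\<dots> = ennreal \<bar>C\<bar> * N (\<lambda>x. 1)" by (rule norm_const)
  also have "\<dots> < \<infinity>" using norm_one by (simp add: ennreal_mult_less_top)
  finally show ?thesis .
qed

lemma norm_sum:
  assumes "finite R" "\<And>r. r \<in> R \<Longrightarrow> F r \<in> borel_measurable unit_measure"
  shows "N (\<lambda>x. \<Sum>r\<in>R. F r x) \<le> (\<Sum>r\<in>R. N (F r))"
  using assms
proof (induction R rule: finite_induct)
  case empty
  then show ?case using norm_eq_0[of "\<lambda>x. 0"] by simp
next
  case (insert r R)
  have "N (\<lambda>x. F r x + (\<Sum>r\<in>R. F r x)) \<le> N (F r) + N (\<lambda>x. \<Sum>r\<in>R. F r x)"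
    using insert by (intro norm_triangle borel_measurable_sum) auto
  then show ?case using insert by (simp add: add_left_mono order_trans)
qed

lemma step_measurable: "step n a \<in> borel_measurable unit_measure"
  by (rule borel_measurable_unit_measure) measurable

lemma norm_step_finite:
  assumes "0 < n" shows "N (step n a) < \<infinity>"
  using step_measurable step_bounded[OF assms] by (rule norm_bounded_finite)

lemma norm_step_mono:
  assumes "0 < n" "\<And>i. i < n \<Longrightarrow> \<bar>a i\<bar> \<le> \<bar>b i\<bar>"
  shows "N (step n a) \<le> N (step n b)"
  unfolding step_def[abs_def]
  by (intro norm_mono step_measurable[unfolded step_def[abs_def]] assms(2) floor_cell(1) assms(1))

end

locale ri_function_norm = function_norm +
  assumes ri: "ri_norm N"
begin

text \<open>The only place where rearrangement invariance enters: the two step functions have the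
  same distribution function.\<close>

lemma norm_step_permute:
  assumes n: "0 < n" and p: "bij_betw p {..<n} {..<n}"
  shows "N (step n (\<lambda>i. a (p i))) = N (step n a)"
proof -
  have c: "card {i. i < n \<and> t < \<bar>a (p i)\<bar>} = card {i. i < n \<and> t < \<bar>a i\<bar>}" for t
  proof (rule bij_betw_same_card[of p])
    have pn: "inj_on p {..<n}" "p ` {..<n} = {..<n}" using p by (auto simp: bij_betw_def)
    show "bij_betw p {i. i < n \<and> t < \<bar>a (p i)\<bar>} {i. i < n \<and> t < \<bar>a i\<bar>}"
      unfolding bij_betw_def
    proof (intro conjI)
      show "inj_on p {i. i < n \<and> t < \<bar>a (p i)\<bar>}" using pn(1) by (rule inj_on_subset) auto
      have "i < n \<Longrightarrow> p i < n" and "i < n \<Longrightarrow> \<exists>k<n. i = p k" for i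
        using pn(2) by (auto simp: set_eq_iff image_iff)
      then show "p ` {i. i < n \<and> t < \<bar>a (p i)\<bar>} = {i. i < n \<and> t < \<bar>a i\<bar>}" by blast
    qed
  qed
  have "rearrangement unit_measure (\<lambda>x. \<bar>step n (\<lambda>i. a (p i)) x\<bar>) s = rearrangement unit_measure (\<lambda>x. \<bar>step n a x\<bar>) s" for s
    unfolding rearrangement_def step_def
      measure_step_level[OF n, of "\<lambda>i. _ < \<bar>a i\<bar>"] measure_step_level[OF n, of "\<lambda>i. _ < \<bar>a (p i)\<bar>"] c ..
  moreover have "step n a \<in> bfs_carrier N"
    using norm_step_finite[OF n] step_measurable by (simp add: bfs_carrier_def)
  ultimately show ?thesis using ri step_measurable unfolding ri_norm_def by blast
qed

text \<open>With \<open>l = d / (b i - b j)\<close> the new sequence is \<open>1 - l\<close> times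
  \<open>b\<close> plus \<open>l\<close> times \<open>b\<close> with \<open>i\<close> and
  \<open>j\<close> exchanged; both have the same norm.\<close>

lemma norm_step_T_transform:
  assumes n: "0 < n" and ij: "i < n" "j < n" "i \<noteq> j" and d: "0 \<le> d" "d < b i - b j"
  shows "N (step n (b(i := b i - d, j := b j + d))) \<le> N (step n b)"
proof -
  define l where "l = d / (b i - b j)"
  have l: "0 \<le> l" "l \<le> 1" using d by (auto simp: l_def)
  have ld: "l * (b i - b j) = d" using d by (simp add: l_def)
  let ?p = "Transposition.transpose i j"
  have p: "bij_betw ?p {..<n} {..<n}" using ij by (intro permutes_imp_bij permutes_swap_id) auto
  have "b(i := b i - d, j := b j + d) = (\<lambda>k. (1 - l) * b k + l * b (?p k))"
    using ij ld by (auto simp: fun_eq_iff Transposition.transpose_def algebra_simps)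
  then have "N (step n (b(i := b i - d, j := b j + d))) = N (\<lambda>x. (1 - l) * step n b x + l * step n (\<lambda>k. b (?p k)) x)"
    by (simp add: step_def[abs_def])
  also have "\<dots> \<le> N (\<lambda>x. (1 - l) * step n b x) + N (\<lambda>x. l * step n (\<lambda>k. b (?p k)) x)"
    by (intro norm_triangle borel_measurable_times step_measurable) auto
  also have "\<dots> = ennreal (1 - l) * N (step n b) + ennreal l * N (step n b)"
    using l by (simp add: norm_scale step_measurable norm_step_permute[OF n p])
  also have "\<dots> = N (step n b)"
    using l by (simp flip: distrib_right ennreal_plus)
  finally show ?thesis .
qed

text \<open>Let \<open>j\<close> be the first index with \<open>a j > b j\<close> and \<open>i < j\<close> the last one before it with \<open>a i < b i\<close>.
  Transferring mass from \<open>b i\<close> to \<open>b j\<close> until one of the two agrees with \<open>a\<close> preserves the hypothesis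
  and reduces the number of indices where \<open>a\<close> and \<open>b\<close> differ.\<close>

lemma norm_step_sorted_majorized:
  assumes n: "0 < n" and a: "\<And>i. i < n \<Longrightarrow> 0 \<le> a i" "\<And>i j. i \<le> j \<Longrightarrow> j < n \<Longrightarrow> a j \<le> a i"
    and "\<And>k. k \<le> n \<Longrightarrow> (\<Sum>i<k. a i) \<le> (\<Sum>i<k. b i)"
  shows "N (step n a) \<le> N (step n b)"
  using assms(4)
proof (induction "card {i. i < n \<and> a i \<noteq> b i}" arbitrary: b rule: less_induct)
  case less
  show ?case
  proof (cases "\<forall>i<n. a i \<le> b i")
    case True
    then show ?thesis using a(1) by (intro norm_step_mono n) (auto intro: order_trans)
  next
    case False
    define j where "j = (LEAST j. j < n \<and> b j < a j)"
    have j: "j < n" "b j < a j" using LeastI_ex[of "\<lambda>j. j < n \<and> b j < a j"] False by (auto simp: j_def not_le)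
    have below: "a l \<le> b l" if "l < j" for l
      using not_less_Least[of l "\<lambda>j. j < n \<and> b j < a j"] that j unfolding j_def by auto
    \<comment> \<open>Otherwise \<open>a\<close> and \<open>b\<close> agree before \<open>j\<close>,
      and the prefix of length \<open>j + 1\<close> violates the hypothesis.\<close>
    have "\<exists>i<j. a i < b i"
    proof (rule ccontr)
      assume *: "\<not> (\<exists>i<j. a i < b i)"
      then have "b l \<le> a l" if "l < j" for l using that by (meson not_less)
      then have "(\<Sum>l<Suc j. b l) < (\<Sum>l<Suc j. a l)" using j
        by (auto intro!: add_le_less_mono sum_mono)
      then show False using less.prems[of "Suc j"] j by simp
    qed
    then have ne: "{i. i < j \<and> a i < b i} \<noteq> {}" and fin: "finite {i. i < j \<and> a i < b i}" by auto
    define i where "i = Max {i. i < j \<and> a i < b i}"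
    have i: "i < j" "a i < b i" using Max_in[OF fin ne] by (auto simp: i_def)
    have between: "a l = b l" if "i < l" "l < j" for l
    proof -
      have "\<not> a l < b l"
      proof
        assume "a l < b l"
        then have "l \<le> i" unfolding i_def using that by (intro Max_ge fin) simp
        then show False using that by simp
      qed
      then show ?thesis using below[of l] that by simp
    qed
    \<comment> \<open>Sortedness gives \<open>b j < a j \<le> a i < b i\<close>, hence
      \<open>d < b i - b j\<close>, as the transfer requires.\<close>
    have aij: "a j \<le> a i" using a(2) i j by simp
    define d where "d = min (b i - a i) (a j - b j)"
    have d: "0 < d" "d < b i - b j" using i j aij by (auto simp: d_def)
    let ?b = "b(i := b i - d, j := b j + d)"
    \<comment> \<open>Prefixes ending at or before \<open>j\<close> compare termwise; longer ones
      contain both \<open>i\<close> and \<open>j\<close>, so their sums do not change.\<close>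
    have pre: "(\<Sum>l<k. a l) \<le> (\<Sum>l<k. ?b l)" if k: "k \<le> n" for k
    proof (cases "k \<le> j")
      case True
      show ?thesis
      proof (rule sum_mono)
        fix l assume "l \<in> {..<k}"
        then have "l < j" using True by simp
        then show "a l \<le> ?b l" using below[of l] by (auto simp: d_def)
      qed
    next
      case False
      have *: "sum g {..<k} = sum g ({..<k} - {i, j}) + (g i + g j)" for g :: "nat \<Rightarrow> real"
        using False i by (subst sum.subset_diff[of "{i, j}"]) auto
      have "sum ?b {..<k} = sum b {..<k}"
        unfolding * using i by (auto intro!: sum.cong)
      then show ?thesis using less.prems[OF k] by simp
    qed
    have "card {l. l < n \<and> a l \<noteq> ?b l} < card {l. l < n \<and> a l \<noteq> b l}"
    proof (rule psubset_card_mono)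
      have "a i = ?b i \<or> a j = ?b j" using i by (auto simp: d_def min_def)
      moreover have "i \<in> {l. l < n \<and> a l \<noteq> b l}" "j \<in> {l. l < n \<and> a l \<noteq> b l}" using i j by simp_all
      ultimately have "\<not> {l. l < n \<and> a l \<noteq> b l} \<subseteq> {l. l < n \<and> a l \<noteq> ?b l}" by blast
      moreover have "{l. l < n \<and> a l \<noteq> ?b l} \<subseteq> {l. l < n \<and> a l \<noteq> b l}"
      proof
        fix l assume l: "l \<in> {l. l < n \<and> a l \<noteq> ?b l}"
        show "l \<in> {l. l < n \<and> a l \<noteq> b l}"
          using l i j by (cases "l = i"; cases "l = j") simp_all
      qed
      ultimately show "{l. l < n \<and> a l \<noteq> ?b l} \<subset> {l. l < n \<and> a l \<noteq> b l}" by blast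
    qed simp
    then have "N (step n a) \<le> N (step n ?b)" using pre by (rule less.hyps)
    also have "\<dots> \<le> N (step n b)" using i j d by (intro norm_step_T_transform n) auto
    finally show ?thesis .
  qed
qed

text \<open>A permutation sorts \<open>a\<close> into decreasing order. Its prefixes are then sums
  of \<open>a\<close> over subsets of the index set, for which the hypothesis is available.\<close>

lemma norm_step_majorized:
  assumes n: "0 < n" and a: "\<And>i. i < n \<Longrightarrow> 0 \<le> a i"
    and le: "\<And>S. S \<subseteq> {..<n} \<Longrightarrow> (\<Sum>i\<in>S. a i) \<le> (\<Sum>i<card S. b i)"
  shows "N (step n a) \<le> N (step n b)"
proof -
  let ?ys = "map a [0..<n]"
  have "mset (rev (sort ?ys)) = mset ?ys" by simp
  then obtain p where p: "p permutes {..<length ?ys}" "permute_list p ?ys = rev (sort ?ys)"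
    by (rule mset_eq_permutation)
  have pn: "p permutes {..<n}" using p(1) by simp
  have nth: "rev (sort ?ys) ! i = a (p i)" if "i < n" for i
    using that permutes_in_image[OF pn] unfolding p(2)[symmetric] by (simp add: permute_list_nth[OF p(1)])
  have b: "bij_betw p {..<n} {..<n}" using pn by (rule permutes_imp_bij)
  have "N (step n a) = N (step n (\<lambda>i. a (p i)))" by (rule norm_step_permute[OF n b, symmetric])
  also have "\<dots> \<le> N (step n b)"
  proof (rule norm_step_sorted_majorized[OF n])
    fix i assume "i < n"
    then show "0 \<le> a (p i)" using a permutes_in_image[OF pn, of i] by simp
  next
    fix i j assume ij: "i \<le> j" "j < n"
    have "rev (sort ?ys) ! j \<le> rev (sort ?ys) ! i"
      using ij by (simp add: rev_nth) (intro sorted_nth_mono, auto)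
    then show "a (p j) \<le> a (p i)" using nth ij by simp
  next
    fix k assume k: "k \<le> n"
    have inj: "inj_on p {..<k}" using permutes_inj[OF pn] by (rule inj_on_subset) simp
    have "p ` {..<k} \<subseteq> p ` {..<n}" using k by (intro image_mono) simp
    then have "p ` {..<k} \<subseteq> {..<n}" unfolding permutes_image[OF pn] .
    from le[OF this] show "(\<Sum>i<k. a (p i)) \<le> (\<Sum>i<k. b i)"
      by (simp add: sum.reindex[OF inj] card_image[OF inj])
  qed
  finally show ?thesis .
qed

text \<open>The cell averages of \<open>w\<close> are the mean of the \<open>m\<close> permutations that rotate every cell cyclically.\<close>

lemma norm_step_average_le:
  assumes n: "0 < n" and m: "0 < m"
  shows "N (step n (\<lambda>i. (\<Sum>q<m. w (i * m + q)) / real m)) \<le> N (step (n * m) w)"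
proof -
  define \<sigma> where "\<sigma> r j = (j div m) * m + (j mod m + r) mod m" for r j
  have \<sigma>: "bij_betw (\<sigma> r) {..<n * m} {..<n * m}" for r
  proof -
    have into: "\<sigma> r ` {..<n * m} \<subseteq> {..<n * m}"
    proof
      fix k assume "k \<in> \<sigma> r ` {..<n * m}"
      then obtain j where j: "j < n * m" "k = \<sigma> r j" by auto
      have "j div m + 1 \<le> n" using j(1) m by (simp add: less_mult_imp_div_less Suc_le_eq)
      then have "(j div m + 1) * m \<le> n * m" by (rule mult_le_mono1)
      moreover have "(j mod m + r) mod m < m" using m by simp
      ultimately show "k \<in> {..<n * m}" using j by (simp add: \<sigma>_def)
    qed
    have divs: "\<sigma> r j div m = j div m" for j using m by (simp add: \<sigma>_def)
    have "inj_on (\<sigma> r) {..<n * m}"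
    proof (rule inj_onI)
      fix j k assume e: "\<sigma> r j = \<sigma> r k"
      then have d: "j div m = k div m" using divs[of j] divs[of k] by simp
      then have "(j mod m + r) mod m = (k mod m + r) mod m" using e by (simp add: \<sigma>_def)
      then have "j mod m = k mod m" by (rule add_mod_eqD) (use m in auto)
      then show "j = k" using d by (metis div_mult_mod_eq)
    qed
    then show ?thesis using endo_inj_surj[OF _ into] by (simp add: bij_betw_def)
  qed
  have rot: "(\<Sum>r<m. g ((c + r) mod m)) = (\<Sum>q<m. g q)" for g :: "nat \<Rightarrow> real" and c
  proof (rule sum.reindex_bij_betw)
    have "inj_on (\<lambda>r. (c + r) mod m) {..<m}"
    proof (rule inj_onI)
      fix r s assume "r \<in> {..<m}" "s \<in> {..<m}" "(c + r) mod m = (c + s) mod m"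
      then show "r = s" by (intro add_mod_eqD[of r c m s]) (simp_all add: add.commute)
    qed
    moreover have "(\<lambda>r. (c + r) mod m) ` {..<m} \<subseteq> {..<m}" using m by auto
    ultimately show "bij_betw (\<lambda>r. (c + r) mod m) {..<m} {..<m}"
      using endo_inj_surj[of "{..<m}"] by (simp add: bij_betw_def)
  qed
  have eq: "step n (\<lambda>i. (\<Sum>q<m. w (i * m + q)) / real m) x =
    (\<Sum>r<m. (1 / real m) * step (n * m) (\<lambda>j. w (\<sigma> r j)) x)" if x: "0 < x" for x
  proof -
    let ?j = "nat \<lfloor>real (n * m) * x\<rfloor>"
    \<comment> \<open>The fine grid refines the coarse one: dividing a fine cell index by
      \<open>m\<close> gives the coarse cell index.\<close>
    have "\<lfloor>real (n * m) * x\<rfloor> div int m = \<lfloor>real (n * m) * x / real_of_int (int m)\<rfloor>"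
      by (rule floor_divide_real_eq_div[symmetric]) simp
    also have "\<dots> = \<lfloor>real n * x\<rfloor>" using m by simp
    finally have "nat (\<lfloor>real (n * m) * x\<rfloor> div int m) = nat \<lfloor>real n * x\<rfloor>" by (rule arg_cong)
    moreover have "0 \<le> real (n * m) * x" using x by simp
    ultimately have d: "?j div m = nat \<lfloor>real n * x\<rfloor>" by (simp add: nat_div_distrib del: of_nat_mult)
    have "(\<Sum>r<m. w (\<sigma> r ?j)) = (\<Sum>q<m. w (nat \<lfloor>real n * x\<rfloor> * m + q))"
      unfolding \<sigma>_def d by (rule rot[of "\<lambda>q. w (nat \<lfloor>real n * x\<rfloor> * m + q)"])
    then show ?thesis by (simp add: step_def sum_divide_distrib[symmetric])
  qed
  have "N (step n (\<lambda>i. (\<Sum>q<m. w (i * m + q)) / real m)) \<le>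
      N (\<lambda>x. \<Sum>r<m. (1 / real m) * step (n * m) (\<lambda>j. w (\<sigma> r j)) x)"
    using eq by (intro norm_mono borel_measurable_sum borel_measurable_times step_measurable) auto
  also have "\<dots> \<le> (\<Sum>r<m. N (\<lambda>x. (1 / real m) * step (n * m) (\<lambda>j. w (\<sigma> r j)) x))"
    by (intro norm_sum borel_measurable_times step_measurable) auto
  also have "\<dots> = (\<Sum>r<m. ennreal (1 / real m) * N (step (n * m) w))"
  proof -
    have "N (step (n * m) (\<lambda>j. w (\<sigma> r j))) = N (step (n * m) w)" for r
      using n m \<sigma> by (intro norm_step_permute) auto
    then show ?thesis by (subst norm_scale[OF step_measurable]) simp
  qed
  also have "\<dots> = (of_nat m * ennreal (1 / real m)) * N (step (n * m) w)" by (simp add: mult.assoc)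
  also have "of_nat m * ennreal (1 / real m) = 1"
    using m by (simp add: ennreal_of_nat_eq_real_of_nat flip: ennreal_mult)
  finally show ?thesis by simp
qed

text \<open>Two Riemann sums of \<open>V\<close> on an \<open>m\<close> times finer grid are
  compared. The left endpoints, averaged over each cell, give \<open>up\<close>, which majorizes
  \<open>a\<close> because its integral dominates that of \<open>V\<close>. The right endpoints give
  \<open>lo\<close>, whose norm is at most \<open>N V\<close> because averaging does not raise the
  norm and the fine step function lies below \<open>V\<close>. The two differ by at most
  \<open>V 0 / m\<close>.\<close>

lemma norm_step_le_antimono:
  assumes n: "0 < n" and V: "\<And>s. 0 \<le> s \<Longrightarrow> s \<le> 1 \<Longrightarrow> 0 \<le> V s" "antimono_on {0..1} V"
    and a: "\<And>i. i < n \<Longrightarrow> 0 \<le> a i"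
    and le: "\<And>S. S \<subseteq> {..<n} \<Longrightarrow>
       ennreal ((\<Sum>i\<in>S. a i) / real n) \<le> (\<integral>\<^sup>+s\<in>{0<..<real (card S) / real n}. ennreal (V s) \<partial>lborel)"
  shows "N (step n a) \<le> N V"
proof (rule ennreal_le_epsilon)
  have anti: "V t \<le> V s" if "0 \<le> s" "s \<le> t" "t \<le> 1" for s t
    using V(2) that by (auto simp: monotone_on_def)
  have Vm: "V \<in> borel_measurable unit_measure"
    by (intro borel_measurable_unit_measure_antimono monotone_on_subset[OF V(2)]) auto
  fix e :: real assume e: "0 < e"
  obtain C where C: "N (\<lambda>x. 1) = ennreal C" "0 \<le> C" using norm_one by (cases "N (\<lambda>x. 1)") auto
  \<comment> \<open>\<open>C\<close> is the norm of the constant 1, so the error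
    \<open>V 0 / m * C\<close> is below \<open>e\<close>.\<close>
  obtain m :: nat where m: "V 0 * C / e < real m" using reals_Archimedean2 by blast
  have "0 \<le> V 0 * C / e" using V(1) C e by simp
  then have m0: "0 < m" using m by (cases m) auto
  define h where "h = 1 / real (n * m)"
  have h: "0 < h" "real (n * m) * h = 1" using n m0 by (auto simp: h_def)
  define w where "w j = V (real (Suc j) * h)" for j
  define up where "up i = (\<Sum>q<m. V (real (i * m + q) * h)) / real m" for i
  define lo where "lo i = (\<Sum>q<m. w (i * m + q)) / real m" for i
  have grid: "real j * h \<le> 1" if "j \<le> n * m" for j
  proof -
    have "real j * h \<le> real (n * m) * h" using that h(1) by (intro mult_right_mono of_nat_mono) auto
    then show ?thesis using h(2) by (simp only:)
  qed
  have cell: "i * m + q < n * m" if "i < n" "q < m" for i q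
  proof -
    have "(i + 1) * m \<le> n * m" using that by (intro mult_le_mono1) simp
    then show ?thesis using that by simp
  qed
  have up0: "0 \<le> up i" if "i < n" for i
    unfolding up_def using cell[OF that] h
    by (intro divide_nonneg_nonneg sum_nonneg V grid) (auto intro: less_imp_le)
  have lo0: "0 \<le> lo i" if "i < n" for i
    unfolding lo_def w_def using cell[OF that] h
    by (intro divide_nonneg_nonneg sum_nonneg V grid) (auto simp: Suc_le_eq)
  \<comment> \<open>Left and right endpoint sums differ by a telescoping sum over the fine grid
    points of the cell.\<close>
  have ul: "up i \<le> lo i + V 0 / real m" if i: "i < n" for i
  proof -
    have "(\<Sum>q<m. V (real (i * m + q) * h)) - (\<Sum>q<m. w (i * m + q)) =
        (\<Sum>q<m. V (real (i * m + q) * h) - V (real (i * m + Suc q) * h))"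
      by (simp add: w_def sum_subtractf add.commute)
    also have "\<dots> = V (real (i * m) * h) - V (real (i * m + m) * h)"
      using sum_lessThan_telescope'[of "\<lambda>q. V (real (i * m + q) * h)" m] by simp
    also have "\<dots> \<le> V 0"
    proof -
      have "i * m + m \<le> n * m" using i by (metis Suc_leI add.commute mult_Suc mult_le_mono1)
      then have "real (i * m) * h \<le> 1" "real (i * m + m) * h \<le> 1" 
        using grid[of "i * m"] grid[of "i * m + m"] by linarith+
      then have "V (real (i * m) * h) \<le> V 0" "0 \<le> V (real (i * m + m) * h)"
        using h by (auto intro!: anti V(1))
      then show ?thesis by simp
    qed
    finally show ?thesis unfolding up_def lo_def using m0 by (simp add: field_simps)
  qed
  have maj: "(\<Sum>i\<in>S. a i) \<le> (\<Sum>i<card S. up i)" if S: "S \<subseteq> {..<n}" for S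
  proof -
    let ?k = "card S"
    have k: "?k \<le> n" using card_mono[OF _ S] by simp
    have kh: "real ?k / real n = real (?k * m) * h" using m0 n by (simp add: h_def)
    have Vpos: "0 \<le> V (real j * h)" if "j < ?k * m" for j
    proof -
      have "j \<le> n * m" using that k by (meson le_trans less_imp_le mult_le_mono1)
      then show ?thesis using h by (intro V(1) grid) auto
    qed
    have "(\<integral>\<^sup>+s\<in>{0<..<real ?k / real n}. ennreal (V s) \<partial>lborel) \<le>
       (\<integral>\<^sup>+s. (\<Sum>j<?k * m. ennreal (V (real j * h)) * indicator {real j * h..<real (Suc j) * h} s) \<partial>lborel)"
    proof (rule nn_integral_mono)
      fix s :: real
      show "ennreal (V s) * indicator {0<..<real ?k / real n} s \<le>
        (\<Sum>j<?k * m. ennreal (V (real j * h)) * indicator {real j * h..<real (Suc j) * h} s)"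
      proof (cases "s \<in> {0<..<real ?k / real n}")
        case True
        define j where "j = nat \<lfloor>s / h\<rfloor>"
        have "0 \<le> s / h" using True h by simp
        then have js: "real j \<le> s / h" "s / h < real j + 1" unfolding j_def by linarith+
        then have j: "real j * h \<le> s" "s < real (Suc j) * h" using h(1) by (auto simp: field_simps)
        have "real j < real (?k * m)" 
        proof -
          have "real j * h < real (?k * m) * h" using j True kh by simp
          then show ?thesis using h(1) by (simp only: mult_less_cancel_right_pos)
        qed
        then have jk: "j \<in> {..<?k * m}" by (simp only: of_nat_less_iff lessThan_iff)
        have "real ?k / real n \<le> 1" using k n by simp
        then have "V s \<le> V (real j * h)" using j True h by (intro anti) auto
        then have "ennreal (V s) * indicator {0<..<real ?k / real n} s \<le> ennreal (V (real j * h)) * indicator {real j * h..<real (Suc j) * h} s"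
          using True j by (simp add: ennreal_leI)
        also have "\<dots> \<le> (\<Sum>j<?k * m. ennreal (V (real j * h)) * indicator {real j * h..<real (Suc j) * h} s)"
          using jk by (intro member_le_sum) auto
        finally show ?thesis .
      qed simp
    qed
    also have "\<dots> = (\<Sum>j<?k * m. ennreal (V (real j * h)) * ennreal h)"
      using h by (subst nn_integral_sum) (auto simp: nn_integral_cmult_indicator algebra_simps intro!: sum.cong)
    also have "\<dots> = ennreal (\<Sum>j<?k * m. V (real j * h) * h)"
      using Vpos h by (subst sum_ennreal[symmetric]) (auto simp: ennreal_mult)
    also have "(\<Sum>j<?k * m. V (real j * h) * h) = (\<Sum>i<?k. up i) / real n"
    proof -
      have "(\<Sum>j<?k * m. V (real j * h)) = (\<Sum>i<?k. \<Sum>q<m. V (real (i * m + q) * h))"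
      proof -
        have "(\<Sum>j\<in>{i * m..<i * m + m}. V (real j * h)) = (\<Sum>q<m. V (real (i * m + q) * h))" for i
          using sum.shift_bounds_nat_ivl[of "\<lambda>j. V (real j * h)" 0 "i * m" m]
          by (simp add: add.commute lessThan_atLeast0)
        then show ?thesis using sum.nat_group[of "\<lambda>j. V (real j * h)" m ?k] by simp
      qed
      then show ?thesis
        unfolding up_def h_def using n m0 by (simp add: sum_distrib_right[symmetric] sum_divide_distrib[symmetric])
    qed
    finally have "ennreal ((\<Sum>i\<in>S. a i) / real n) \<le> ennreal ((\<Sum>i<?k. up i) / real n)"
      using le[OF S] by (rule order_trans[rotated])
    moreover have "0 \<le> (\<Sum>i<?k. up i) / real n"
      using up0 k by (intro divide_nonneg_nonneg sum_nonneg) auto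
    ultimately show ?thesis using n by (simp add: ennreal_le_iff divide_le_cancel)
  qed
  have "N (step n a) \<le> N (step n up)" using n a maj by (rule norm_step_majorized)
  also have "\<dots> \<le> N (step n (\<lambda>i. lo i + V 0 / real m))"
    by (intro norm_step_mono n) (metis abs_of_nonneg order_trans ul up0)
  also have "\<dots> = N (\<lambda>x. step n lo x + V 0 / real m)" by (simp add: step_def[abs_def])
  also have "\<dots> \<le> N (step n lo) + N (\<lambda>x. V 0 / real m)"
    by (intro norm_triangle step_measurable) auto
  also have "\<dots> \<le> N V + ennreal e"
  proof (rule add_mono)
    have "N (step n lo) \<le> N (step (n * m) w)" unfolding lo_def by (rule norm_step_average_le[OF n m0])
    also have "\<dots> \<le> N V"
    proof (rule norm_mono[OF step_measurable Vm])
      fix x :: real assume x: "0 < x" "x < 1"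
      let ?j = "nat \<lfloor>real (n * m) * x\<rfloor>"
      have nm: "0 < n * m" using n m0 by simp
      note j = floor_cell[OF x nm]
      have "real (Suc ?j) * h \<le> 1" using j(1) by (intro grid) simp
      moreover have "x \<le> real (Suc ?j) * h" using j(3) nm unfolding h_def by (simp add: field_simps)
      ultimately have "V (real (Suc ?j) * h) \<le> V x" "0 \<le> V (real (Suc ?j) * h)"
        using x h by (auto intro!: anti V(1))
      then show "\<bar>step (n * m) w x\<bar> \<le> \<bar>V x\<bar>" by (simp add: step_def w_def)
    qed
    finally show "N (step n lo) \<le> N V" .
    have "N (\<lambda>x. V 0 / real m) = ennreal (V 0 / real m * C)"
      using V(1)[of 0] C by (subst norm_const) (simp flip: ennreal_mult)
    also have "\<dots> \<le> ennreal e" using m m0 e by (intro ennreal_leI) (simp add: field_simps)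
    finally show "N (\<lambda>x. V 0 / real m) \<le> ennreal e" .
  qed
  finally show "N (step n a) \<le> N V + ennreal e" .
qed

end

section \<open>Symmetrization\<close>

text \<open>For bounded nonnegative \<open>v\<close> the value at \<open>s = 0\<close> is meaningful
  too. It is included because \<open>norm_step_le_antimono\<close> measures its error by
  \<open>V 0\<close>.\<close>

lemma (in prob_space) rearrangement_bounded:
  assumes v: "\<And>x. x \<in> space M \<Longrightarrow> 0 \<le> v x" "\<And>x. x \<in> space M \<Longrightarrow> v x \<le> L" and s: "0 \<le> s" "s < 1"
  shows rearrangement_nonneg: "0 \<le> rearrangement M v s"
    and rearrangement_antimono_bounded: "s \<le> t \<Longrightarrow> t < 1 \<Longrightarrow> rearrangement M v t \<le> rearrangement M v s"
proof -
  have pos: "0 \<le> \<tau>" if "measure M {x \<in> space M. v x > \<tau>} \<le> t" "t < 1" for \<tau> t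
  proof (rule ccontr)
    assume "\<not> 0 \<le> \<tau>"
    then have "{x \<in> space M. v x > \<tau>} = space M" using v(1) by fastforce
    then show False using that prob_space by simp
  qed
  have e: "{x \<in> space M. v x > L} = {}" using v(2) by fastforce
  have ne: "L \<in> {\<tau>. measure M {x \<in> space M. v x > \<tau>} \<le> s}" using s unfolding mem_Collect_eq e by simp
  show "0 \<le> rearrangement M v s"
    unfolding rearrangement_def using ne pos s by (intro cInf_greatest) auto
  show "rearrangement M v t \<le> rearrangement M v s" if "s \<le> t" "t < 1"
    unfolding rearrangement_def using ne pos that
    by (intro cInf_superset_mono) (auto intro!: bdd_belowI[of _ 0])
qed

section \<open>Monotonicity of the isoperimetric estimator\<close>

locale isoperimetric_setting =
  fixes M :: "'a::metric_space measure" and J :: "real \<Rightarrow> real"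
  assumes space: "isoperimetric_space M" and estimator: "isoperimetric_estimator M J"
begin

sublocale prob_space M
  using space by (simp add: isoperimetric_space_def)

lemma sets_M: "sets M = sets borel"
  using space by (simp add: isoperimetric_space_def)

lemma space_M [simp]: "space M = UNIV"
  using sets_eq_imp_space_eq[OF sets_M] by simp

lemma measurable_M: "measurable M X = measurable borel X"
  using sets_M by (rule measurable_cong_sets) simp

lemma J_nonneg: "0 \<le> t \<Longrightarrow> t \<le> 1/2 \<Longrightarrow> 0 \<le> J t"
  using estimator by (auto simp: isoperimetric_estimator_def)

lemma J_extension:
  obtains K where "continuous_on {0..1} K" "concave_on {0..1} K" "K 0 = 0"
    "\<And>s. 0 \<le> s \<Longrightarrow> s \<le> 1 \<Longrightarrow> K (1 - s) = K s" "\<And>t. 0 \<le> t \<Longrightarrow> t \<le> 1/2 \<Longrightarrow> J t = K t"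
  using estimator by (auto simp: isoperimetric_estimator_def)

lemma continuous_on_J: "continuous_on {0..1/2} J"
proof -
  obtain K where K: "continuous_on {0..1} K" "\<And>t. 0 \<le> t \<Longrightarrow> t \<le> 1/2 \<Longrightarrow> J t = K t"
    by (rule J_extension) blast
  have "continuous_on {0..1/2} K" using K(1) by (rule continuous_on_subset) auto
  then show ?thesis by (rule continuous_on_eq) (use K in auto)
qed

text \<open>The point \<open>b\<close> lies between \<open>a\<close> and \<open>1 - a\<close>, where
  the symmetric concave extension takes the same value.\<close>

lemma J_mono:
  assumes "0 \<le> a" "a \<le> b" "b \<le> 1/2"
  shows "J a \<le> J b"
proof (cases "a = b")
  case False
  obtain K where K: "concave_on {0..1} K" "\<And>s. 0 \<le> s \<Longrightarrow> s \<le> 1 \<Longrightarrow> K (1 - s) = K s"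
      "\<And>t. 0 \<le> t \<Longrightarrow> t \<le> 1/2 \<Longrightarrow> J t = K t"
    by (rule J_extension) blast
  have d: "0 < 1 - 2 * a" using assms False by simp
  define t where "t = (b - a) / (1 - 2 * a)"
  have t: "0 \<le> t" "t \<le> 1" using assms d by (auto simp: t_def)
  have "t * (1 - 2 * a) = b - a" using d by (simp add: t_def)
  then have e: "(1 - t) * a + t * (1 - a) = b" by (simp add: algebra_simps)
  have "(1 - t) * K a + t * K (1 - a) \<le> K ((1 - t) *\<^sub>R a + t *\<^sub>R (1 - a))"
    using assms by (intro concave_onD[OF K(1)] t) auto
  then have "K a \<le> K b" using K(2)[of a] assms e by (simp add: algebra_simps)
  then show ?thesis using K(3) assms by simp
qed simp

text \<open>Concavity on the chord from 0, where the extension vanishes: \<open>J t / t\<close> is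
  decreasing.\<close>

lemma J_ratio:
  assumes "0 < a" "a \<le> b" "b \<le> 1/2"
  shows "J b * a \<le> J a * b"
proof -
  obtain K where K: "concave_on {0..1} K" "K 0 = 0" "\<And>t. 0 \<le> t \<Longrightarrow> t \<le> 1/2 \<Longrightarrow> J t = K t"
    by (rule J_extension) blast
  have t: "0 \<le> a / b" "a / b \<le> 1" using assms by auto
  have "(1 - a / b) * K 0 + (a / b) * K b \<le> K ((1 - a / b) *\<^sub>R 0 + (a / b) *\<^sub>R b)"
    using assms by (intro concave_onD[OF K(1)] t) auto
  then show ?thesis using assms K(2,3) by (simp add: field_simps)
qed

text \<open>Continuity of both sides extends the estimator inequality to \<open>t = 1/2\<close>;
  superlevel sets of measure exactly one half do occur.\<close>

lemma J_le_iso_profile: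
  assumes t: "0 < t" "t \<le> 1/2"
  shows "ennreal (J t) \<le> iso_profile M t"
proof -
  let ?I = "\<lambda>s. enn2real (iso_profile M s)"
  have fin: "iso_profile M s < \<infinity>" if "0 \<le> s" "s \<le> 1" for s
    using space that by (auto simp: isoperimetric_space_def)
  have c: "continuous_on {0..1/2} (\<lambda>s. ?I s - J s)"
  proof (intro continuous_on_diff continuous_on_J)
    have "continuous_on {0..1} ?I" using space by (simp add: isoperimetric_space_def)
    then show "continuous_on {0..1/2} ?I" by (rule continuous_on_subset) auto
  qed
  have cl: "closure {0<..<1/2} = {0..1/2::real}" by simp
  have "0 \<le> ?I t - J t"
  proof (rule continuous_ge_on_closure[OF c[folded cl]])
    fix s :: real assume s: "s \<in> {0<..<1/2}"
    then have "ennreal (J s) \<le> iso_profile M s" using estimator by (auto simp: isoperimetric_estimator_def)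
    then have "enn2real (ennreal (J s)) \<le> ?I s" using fin[of s] s by (intro enn2real_mono) auto
    then show "0 \<le> ?I s - J s" using s J_nonneg[of s] by simp
  qed (use cl t in auto)
  then have "ennreal (J t) \<le> ennreal (?I t)" by (intro ennreal_leI) simp
  also have "ennreal (?I t) = iso_profile M t" using fin[of t] t by (intro ennreal_enn2real) simp
  finally show ?thesis .
qed

end

section \<open>Level shells of a Lipschitz function and the increments of its rearrangement\<close>

locale lipschitz_setting = isoperimetric_setting +
  fixes u :: "'a::metric_space \<Rightarrow> real" and L :: real
  assumes lipschitz: "L-lipschitz_on UNIV u"
begin

abbreviation R :: "real \<Rightarrow> real" where "R \<equiv> rearrangement M u"

abbreviation grad :: "'a \<Rightarrow> real" where "grad \<equiv> grad_modulus u"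

lemma u_measurable [measurable]: "u \<in> borel_measurable M"
  unfolding measurable_M by (intro borel_measurable_continuous_onI lipschitz_on_continuous_on[OF lipschitz])

lemma grad_measurable [measurable]: "grad \<in> borel_measurable M"
  unfolding measurable_M by (intro borel_measurable_grad_modulus lipschitz_on_continuous_on[OF lipschitz])

text \<open>Strict inequalities on both sides keep possible level sets of positive measure at
  \<open>R s\<close> and \<open>R t\<close> out; otherwise the bound \<open>t - s\<close> on the
  measure could fail.\<close>

definition level_shell :: "real \<Rightarrow> real \<Rightarrow> 'a set" where
  "level_shell s t = {x. R t < u x \<and> u x < R s}"

lemma level_shell_sets [measurable]: "level_shell s t \<in> sets M"
proof -
  have "{x \<in> space M. R t < u x \<and> u x < R s} \<in> sets M" by measurable
  then show ?thesis by (simp add: level_shell_def)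
qed

lemma measure_level_shell:
  assumes "0 < s" "s \<le> t" "t < 1"
  shows "measure M (level_shell s t) \<le> t - s"
proof (cases "R t < R s")
  case True
  have m: "{x. R t < u x} \<in> sets M" "{x. R s \<le> u x} \<in> sets M"
    using measurable_sets[OF u_measurable, of "{R t<..}"] measurable_sets[OF u_measurable, of "{R s..}"]
    by (auto simp: vimage_def)
  have e: "level_shell s t = {x. R t < u x} - {x. R s \<le> u x}" by (auto simp: level_shell_def)
  have "{x. R s \<le> u x} \<subseteq> {x. R t < u x}" using True by auto
  then have "measure M (level_shell s t) = measure M {x. R t < u x} - measure M {x. R s \<le> u x}"
    unfolding e by (rule finite_measure_Diff[OF m])
  also have "\<dots> \<le> t - s"
    using rearrangement_le_iff[OF u_measurable, of t "R t"] measure_ge_rearrangement[OF u_measurable, of s] assms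
    by simp
  finally show ?thesis .
next
  case False
  then have "level_shell s t = {}" by (auto simp: level_shell_def)
  then show ?thesis using assms by simp
qed

text \<open>Such a level cuts off a set of measure in \<open>(s, t]\<close>. There \<open>J\<close>
  is at least \<open>J s\<close> by monotonicity, and the profile is at least
  \<open>J\<close>.\<close>

lemma perimeter_superlevel:
  assumes s: "0 < s" "s \<le> t" "t \<le> 1/2" and \<tau>: "R t < \<tau>" "\<tau> < R s"
  shows "ennreal (J s) \<le> perimeter M {x. \<tau> < u x}"
proof -
  let ?m = "measure M {x. \<tau> < u x}"
  have m: "s < ?m" "?m \<le> t"
    using rearrangement_le_iff[OF u_measurable, of s \<tau>] rearrangement_le_iff[OF u_measurable, of t \<tau>] s \<tau> by auto
  have "ennreal (J s) \<le> ennreal (J ?m)" using m s by (intro ennreal_leI J_mono) auto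
  also have "\<dots> \<le> iso_profile M ?m" using m s by (intro J_le_iso_profile) auto
  also have "\<dots> \<le> perimeter M {x. \<tau> < u x}"
  proof -
    have "{x. \<tau> < u x} \<in> sets borel"
      using measurable_sets[OF u_measurable, of "{\<tau><..}"] sets_M by (auto simp: vimage_def)
    then show ?thesis unfolding iso_profile_def by (intro INF_lower) simp
  qed
  finally show ?thesis .
qed

text \<open>The coarea inequality includes its lower level, the shell does not. It is applied from a
  level \<open>a\<close> slightly above \<open>R t\<close>.\<close>

lemma level_shell_lower_bound:
  assumes s: "0 < s" "s \<le> t" "t \<le> 1/2"
  shows "ennreal (J s * (R s - R t)) \<le> (\<integral>\<^sup>+x\<in>level_shell s t. ennreal (grad x) \<partial>M)"
proof (cases "R t < R s")
  case True
  have J: "0 \<le> J s" using s by (intro J_nonneg) auto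
  show ?thesis
  proof (rule ennreal_le_epsilon)
    fix e :: real assume e: "0 < e"
    \<comment> \<open>The first bound keeps \<open>a\<close> below \<open>R s\<close>, the second
      makes the loss \<open>J s * (a - R t)\<close> at most \<open>e\<close>; adding 1 covers
      \<open>J s = 0\<close>.\<close>
    define a where "a = R t + min ((R s - R t) / 2) (e / (J s + 1))"
    have a: "R t < a" "a \<le> R s" "a - R t \<le> e / (J s + 1)" 
    proof -
      have "0 < e / (J s + 1)" using e J by (intro divide_pos_pos) auto
      then show "R t < a" "a - R t \<le> e / (J s + 1)" using True by (auto simp: a_def)
      have "a \<le> R t + (R s - R t) / 2" unfolding a_def by (intro add_left_mono min.cobounded1)
      then show "a \<le> R s" using True by (simp add: field_simps)
    qed
    have "J s * (a - R t) \<le> J s * (e / (J s + 1))" using a(3) J by (rule mult_left_mono)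
    also have "\<dots> \<le> e" using J e by (simp add: field_simps)
    finally have "ennreal (J s * (R s - R t)) \<le> ennreal (J s * (R s - a) + e)"
      by (intro ennreal_leI) (simp add: algebra_simps)
    also have "\<dots> = ennreal (J s * (R s - a)) + ennreal e" using a J e by (intro ennreal_plus) auto
    also have "ennreal (J s * (R s - a)) \<le> (\<integral>\<^sup>+x\<in>{x. a \<le> u x \<and> u x < R s}. ennreal (grad x) \<partial>M)"
      using a by (intro coarea_lower_bound[OF prob_space_axioms sets_M lipschitz J] perimeter_superlevel[OF s]) auto
    also have "\<dots> \<le> (\<integral>\<^sup>+x\<in>level_shell s t. ennreal (grad x) \<partial>M)"
      using a by (intro nn_integral_mono) (auto simp: level_shell_def split: split_indicator)
    finally show "ennreal (J s * (R s - R t)) \<le> (\<integral>\<^sup>+x\<in>level_shell s t. ennreal (grad x) \<partial>M) + ennreal e"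
      by (simp add: add_right_mono)
  qed
next
  case False
  then have "J s * (R s - R t) \<le> 0" using s J_nonneg[of s] by (simp add: mult_nonneg_nonpos)
  then show ?thesis by (simp add: ennreal_neg)
qed

text \<open>\<open>increments k\<close> discretizes \<open>(- R') J\<close> on the grid of mesh \<open>1 / (2 k)\<close> in \<open>(0, 1/2)\<close>.\<close>

definition increments :: "nat \<Rightarrow> nat \<Rightarrow> real" where
  "increments k i = (if 0 < i \<and> i < k then
     real (2 * k) * (J (real i / real (2 * k)) * (R (real i / real (2 * k)) - R (real (Suc i) / real (2 * k)))) else 0)"

lemma grid_points:
  assumes "0 < i" "i < k"
  shows "0 < real i / real (2 * k)" "real i / real (2 * k) \<le> real (Suc i) / real (2 * k)"
    "real (Suc i) / real (2 * k) \<le> 1/2"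
  using assms by (auto simp: field_simps)

lemma increments_nonneg: "0 \<le> increments k i"
proof (cases "0 < i \<and> i < k")
  case True
  note g = grid_points[of i k]
  have "R (real (Suc i) / real (2 * k)) \<le> R (real i / real (2 * k))"
    using g True by (intro rearrangement_antimono[OF u_measurable]) auto
  moreover have "0 \<le> J (real i / real (2 * k))" using g True by (intro J_nonneg) auto
  ultimately show ?thesis using True by (simp add: increments_def)
qed (auto simp: increments_def)

text \<open>The shells of different cells are disjoint and each has measure at most the mesh. Their
  union is thus an admissible set in the Hardy-Littlewood inequality for the gradient.\<close>

lemma sum_increments_le:
  assumes k: "0 < k" and S: "S \<subseteq> {..<2 * k}"
  shows "ennreal ((\<Sum>i\<in>S. increments k i) / real (2 * k)) \<le>
    (\<integral>\<^sup>+s\<in>{0<..<real (card S) / real (2 * k)}. ennreal (rearrangement M grad s) \<partial>lborel)"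
proof -
  \<comment> \<open>The indices outside \<open>T\<close> carry increment 0. Cell 0 is among them
    because \<open>R 0\<close> need not be meaningful.\<close>
  define T where "T = {i \<in> S. 0 < i \<and> i < k}"
  have finS: "finite S" using S by (rule finite_subset) simp
  then have finT: "finite T" by (simp add: T_def)
  let ?p = "\<lambda>i. real i / real (2 * k)"
  let ?E = "\<lambda>i. level_shell (?p i) (?p (Suc i))"
  have "(\<Sum>i\<in>S. increments k i) = (\<Sum>i\<in>T. increments k i)"
    using finS by (intro sum.mono_neutral_right) (auto simp: T_def increments_def)
  then have "ennreal ((\<Sum>i\<in>S. increments k i) / real (2 * k)) = (\<Sum>i\<in>T. ennreal (increments k i / real (2 * k)))"
    using increments_nonneg by (simp add: sum_divide_distrib sum_ennreal)
  also have "\<dots> \<le> (\<Sum>i\<in>T. \<integral>\<^sup>+x\<in>?E i. ennreal (grad x) \<partial>M)"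
  proof (rule sum_mono)
    fix i assume "i \<in> T"
    then have i: "0 < i" "i < k" by (auto simp: T_def)
    then have "increments k i / real (2 * k) = J (?p i) * (R (?p i) - R (?p (Suc i)))"
      by (simp add: increments_def)
    then show "ennreal (increments k i / real (2 * k)) \<le> (\<integral>\<^sup>+x\<in>?E i. ennreal (grad x) \<partial>M)"
      using level_shell_lower_bound[OF grid_points[OF i]] by (simp only:)
  qed
  also have "\<dots> = (\<integral>\<^sup>+x. (\<Sum>i\<in>T. ennreal (grad x) * indicator (?E i) x) \<partial>M)"
    by (subst nn_integral_sum) auto
  also have "\<dots> = (\<integral>\<^sup>+x\<in>(\<Union>i\<in>T. ?E i). ennreal (grad x) \<partial>M)"
  proof (intro nn_integral_cong)
    fix x
    have "disjoint_family_on ?E T"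
    proof -
      have "?E i \<inter> ?E j = {}" if "i \<in> T" "j \<in> T" "i < j" for i j
      proof -
        have "R (?p j) \<le> R (?p (Suc i))"
          using that grid_points[of j k] by (intro rearrangement_antimono[OF u_measurable]) (auto simp: T_def divide_right_mono)
        then show ?thesis by (auto simp: level_shell_def)
      qed
      then show ?thesis unfolding disjoint_family_on_def by (metis Int_commute linorder_neqE_nat)
    qed
    then have "indicator (\<Union>i\<in>T. ?E i) x = (\<Sum>i\<in>T. indicator (?E i) x :: ennreal)"
      by (intro indicator_UN_disjoint finT)
    then show "(\<Sum>i\<in>T. ennreal (grad x) * indicator (?E i) x) = ennreal (grad x) * indicator (\<Union>i\<in>T. ?E i) x"
      by (simp add: sum_distrib_left)
  qed
  also have "\<dots> \<le> (\<integral>\<^sup>+s\<in>{0<..<real (card S) / real (2 * k)}. ennreal (rearrangement M grad s) \<partial>lborel)"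
  proof (rule hardy_littlewood_rearrangement[OF grad_measurable])
    show "(\<Union>i\<in>T. ?E i) \<in> sets M" using finT by (intro sets.finite_UN) auto
    have "measure M (\<Union>i\<in>T. ?E i) \<le> (\<Sum>i\<in>T. measure M (?E i))"
      by (intro finite_measure_subadditive_finite finT) auto
    also have "\<dots> \<le> (\<Sum>i\<in>T. 1 / real (2 * k))"
    proof (rule sum_mono)
      fix i assume "i \<in> T"
      then have i: "0 < i" "i < k" by (auto simp: T_def)
      have "measure M (?E i) \<le> ?p (Suc i) - ?p i"
        using grid_points[OF i] by (intro measure_level_shell) linarith+
      also have "\<dots> = 1 / real (2 * k)" by (simp add: diff_divide_distrib[symmetric])
      finally show "measure M (?E i) \<le> 1 / real (2 * k)" .
    qed
    also have "\<dots> = real (card T) / real (2 * k)" by simp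
    also have "\<dots> \<le> real (card S) / real (2 * k)"
      using finS by (intro divide_right_mono) (auto simp: T_def intro!: card_mono)
    finally show "measure M (\<Union>i\<in>T. ?E i) \<le> real (card S) / real (2 * k)" .
    have "card S \<le> card {..<2 * k}" using S by (intro card_mono) auto
    then show "real (card S) / real (2 * k) \<le> 1" using k by simp
  qed
  finally show ?thesis .
qed

lemma grad_bounds: "0 \<le> grad x" "grad x \<le> L"
  using ennreal_grad_modulus(2)[OF lipschitz] grad_modulus_nonneg by auto

lemma rearrangement_grad_measurable: "rearrangement M grad \<in> borel_measurable unit_measure"
  by (intro borel_measurable_unit_measure_antimono monotone_onI)
    (auto intro!: rearrangement_antimono_bounded[where L = L] grad_bounds)

end

lemma (in ri_function_norm) norm_increments_le:
  assumes "lipschitz_setting M J u L" and k: "0 < k"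
  shows "N (step (2 * k) (lipschitz_setting.increments M J u k)) \<le> N (rearrangement M (grad_modulus u))"
proof -
  interpret lipschitz_setting M J u L by fact
  \<comment> \<open>At \<open>s = 1\<close> the defining infimum ranges over all reals, so the value
    is replaced by 0; the norm does not see this point.\<close>
  define V where "V s = (if s < 1 then rearrangement M grad s else 0)" for s
  have V: "0 \<le> V s" if "0 \<le> s" "s \<le> 1" for s
    unfolding V_def using that grad_bounds by (auto intro!: rearrangement_nonneg[where L = L])
  have Va: "antimono_on {0..1} V"
  proof (rule monotone_onI)
    fix s t :: real assume "s \<in> {0..1}" "t \<in> {0..1}" "s \<le> t"
    then show "V t \<le> V s"
      using V[of s] by (auto simp: V_def intro!: rearrangement_antimono_bounded[where L = L] grad_bounds)
  qed
  have "N (step (2 * k) (increments k)) \<le> N V"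
  proof (rule norm_step_le_antimono[OF _ V Va])
    fix S assume S: "S \<subseteq> {..<2 * k}"
    have "card S \<le> card {..<2 * k}" using S by (intro card_mono) auto
    then have "real (card S) / real (2 * k) \<le> 1" using k by simp
    then have "ennreal (rearrangement M grad s) * indicator {0<..<real (card S) / real (2 * k)} s =
        ennreal (V s) * indicator {0<..<real (card S) / real (2 * k)} s" for s
      by (auto simp: V_def split: split_indicator)
    then show "ennreal ((\<Sum>i\<in>S. increments k i) / real (2 * k)) \<le>
       (\<integral>\<^sup>+s\<in>{0<..<real (card S) / real (2 * k)}. ennreal (V s) \<partial>lborel)"
      using sum_increments_le[OF k S] by (simp only:)
  qed (use k increments_nonneg in auto)
  also have "\<dots> \<le> N (rearrangement M grad)"
    by (intro norm_mono rearrangement_grad_measurable borel_measurable_unit_measure_antimono monotone_on_subset[OF Va])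
      (auto simp: V_def)
  finally show ?thesis .
qed

section \<open>Hardy operators\<close>

lemma step_nonneg: "(\<And>i. 0 \<le> a i) \<Longrightarrow> 0 \<le> step n a x"
  by (simp add: step_def)

lemma set_integrable_bounded_interval:
  fixes \<phi> :: "real \<Rightarrow> real"
  assumes "\<phi> \<in> borel_measurable borel" "\<And>z. a < z \<Longrightarrow> z < b \<Longrightarrow> \<bar>\<phi> z\<bar> \<le> B"
  shows "set_integrable lebesgue {a<..<b} \<phi>"
  unfolding set_integrable_def
proof (rule integrableI_bounded_set[where A = "{a<..<b}" and B = B])
  have "(\<lambda>z. indicator {a<..<b} z *\<^sub>R \<phi> z) \<in> borel_measurable borel" using assms(1) by measurable
  then show "(\<lambda>z. indicator {a<..<b} z *\<^sub>R \<phi> z) \<in> borel_measurable lebesgue"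
    by (intro measurable_completion) simp
  show "emeasure lebesgue {a<..<b} < \<infinity>" by (cases "a \<le> b") auto
qed (use assms(2) in auto)

lemma set_integrable_div_self:
  fixes g :: "real \<Rightarrow> real"
  assumes g: "g \<in> borel_measurable borel" "\<And>z. 0 < z \<Longrightarrow> z < 1 \<Longrightarrow> \<bar>g z\<bar> \<le> B" and s: "0 < s"
  shows "set_integrable lebesgue {s<..<1} (\<lambda>z. g z / z)"
proof (rule set_integrable_bounded_interval)
  fix z assume z: "s < z" "z < 1"
  then have "\<bar>g z\<bar> / z \<le> B / s" using g(2)[of z] s abs_ge_zero[of "g z"] by (intro frac_le) auto
  then show "\<bar>g z / z\<bar> \<le> B / s" using z s by simp
qed (use g in measurable)

lemma hardy_Q_antimono:
  assumes g: "g \<in> borel_measurable borel" "\<And>z. 0 < z \<Longrightarrow> z < 1 \<Longrightarrow> \<bar>g z\<bar> \<le> B" "\<And>z. 0 \<le> g z"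
    and s: "0 < s" "s \<le> t"
  shows "hardy_Q g t \<le> hardy_Q g s"
  unfolding hardy_Q_def set_lebesgue_integral_def
proof (rule integral_mono)
  show "integrable lebesgue (\<lambda>z. indicator {s<..<1} z *\<^sub>R (g z / z))" "integrable lebesgue (\<lambda>z. indicator {t<..<1} z *\<^sub>R (g z / z))"
    using set_integrable_div_self[OF g(1,2)] s by (auto simp: set_integrable_def)
qed (use g s in \<open>auto split: split_indicator\<close>)

lemma hardy_Q_nonneg: "(\<And>z. 0 \<le> g z) \<Longrightarrow> 0 < s \<Longrightarrow> 0 \<le> hardy_Q g s"
  unfolding hardy_Q_def set_lebesgue_integral_def
  by (intro integral_nonneg_AE AE_I2) (auto split: split_indicator)

section \<open>Splitting the integral of \<open>g / J\<close> between the two Hardy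
  operators\<close>

locale positive_isoperimetric_setting = isoperimetric_setting +
  assumes J_pos: "0 < t \<Longrightarrow> t \<le> 1/2 \<Longrightarrow> 0 < J t"
begin

lemma set_integrable_div_J:
  assumes g: "g \<in> borel_measurable borel" "\<And>z. 0 < z \<Longrightarrow> z < 1 \<Longrightarrow> \<bar>g z\<bar> \<le> B" and s: "0 < s"
  shows "set_integrable lebesgue {s<..<1/2} (\<lambda>z. g z / J z)"
proof -
  have J': "(\<lambda>z. indicator {0..1/2} z *\<^sub>R J z) \<in> borel_measurable borel"
    by (intro borel_measurable_continuous_on_indicator continuous_on_J) simp
  have "set_integrable lebesgue {s<..<1/2} (\<lambda>z. g z / (indicator {0..1/2} z *\<^sub>R J z))"
  proof (rule set_integrable_bounded_interval)
    fix z :: real assume z: "s < z" "z < 1/2"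
    then have "\<bar>g z\<bar> / J z \<le> B / J s" using g(2)[of z] s abs_ge_zero[of "g z"]
      by (intro frac_le J_mono J_pos) auto
    then show "\<bar>g z / (indicator {0..1/2} z *\<^sub>R J z)\<bar> \<le> B / J s" using z s J_pos[of z] by simp
  qed (use g J' in measurable)
  moreover have "set_integrable lebesgue {s<..<1/2} (\<lambda>z. g z / (indicator {0..1/2} z *\<^sub>R J z)) \<longleftrightarrow>
      set_integrable lebesgue {s<..<1/2} (\<lambda>z. g z / J z)"
    by (rule set_integrable_cong) (use s in auto)
  ultimately show ?thesis by (rule iffD1[rotated])
qed

lemma integral_div_J_nonneg: "(\<And>z. 0 \<le> g z) \<Longrightarrow> 0 < s \<Longrightarrow> 0 \<le> (LINT z:{s<..<1/2}|lebesgue. g z / J z)"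
  unfolding set_lebesgue_integral_def using J_nonneg
  by (intro integral_nonneg_AE AE_I2) (auto split: split_indicator)

text \<open>Pointwise, with a split at \<open>t\<close>. For \<open>z \<le> t\<close> one has
  \<open>z / J z \<le> t / J t\<close>, and the term \<open>g z / z\<close> of \<open>Q\<close>
  suffices. For \<open>z > t\<close> the term of \<open>iso_hardy_Q\<close> suffices, since
  \<open>(t / J t) * (J s / s)\<close> is at least 1.\<close>

lemma integral_div_J_le:
  assumes g: "g \<in> borel_measurable borel" "\<And>z. 0 < z \<Longrightarrow> z < 1 \<Longrightarrow> \<bar>g z\<bar> \<le> B" "\<And>z. 0 \<le> g z"
    and s: "0 < s" "s \<le> t" "t < 1/2"
  shows "(LINT z:{s<..<1/2}|lebesgue. g z / J z) \<le> t / J t * (hardy_Q g s + iso_hardy_Q J g s)"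
proof -
  let ?c = "t / J t" and ?d = "J s / s"
  let ?p = "\<lambda>z. indicator {s<..<1/2} z *\<^sub>R (g z / J z)" and ?q = "\<lambda>z. indicator {s<..<1} z *\<^sub>R (g z / z)"
  have Js: "0 < J s" and Jt: "0 < J t" using s by (auto intro: J_pos)
  have c: "0 < ?c" using s Jt by simp
  have d: "0 < ?d" using s Js by simp
  have ip: "integrable lebesgue ?p" using set_integrable_div_J[OF g(1,2) s(1)] by (simp add: set_integrable_def)
  have iq: "integrable lebesgue ?q" using set_integrable_div_self[OF g(1,2) s(1)] by (simp add: set_integrable_def)
  have "integral\<^sup>L lebesgue ?p \<le> integral\<^sup>L lebesgue (\<lambda>z. ?c * (?q z + ?d * ?p z))"
  proof (rule integral_mono)
    show "integrable lebesgue (\<lambda>z. ?c * (?q z + ?d * ?p z))"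
      using ip iq by (intro integrable_mult_right Bochner_Integration.integrable_add)
    show "integrable lebesgue ?p" by (rule ip)
    fix z :: real
    show "?p z \<le> ?c * (?q z + ?d * ?p z)"
    proof (cases "s < z \<and> z < 1/2")
      case True
      then have Jz: "0 < J z" using s by (intro J_pos) auto
      have gJ: "0 \<le> g z / J z" "0 \<le> g z / z" using g(3)[of z] Jz True s by auto
      have "g z / J z \<le> ?c * (g z / z + ?d * (g z / J z))"
      proof (cases "z \<le> t")
        case z: True
        have "J t * z \<le> J z * t" using True s z by (intro J_ratio) auto
        then have "z / J z \<le> t / J t" using Jz Jt by (simp add: field_simps)
        then have "(z / J z) * (g z / z) \<le> ?c * (g z / z)" using gJ by (intro mult_right_mono)
        then have "g z / J z \<le> ?c * (g z / z)" using True s by simp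
        moreover have "0 \<le> ?c * (?d * (g z / J z))" using c d gJ by (intro mult_nonneg_nonneg) auto
        ultimately show ?thesis by (simp only: distrib_left)
      next
        case False
        have "J t * s \<le> J s * t" using s by (intro J_ratio) auto
        then have "1 \<le> ?c * ?d" using s Jt by (simp add: field_simps)
        then have "1 * (g z / J z) \<le> ?c * ?d * (g z / J z)" using gJ by (intro mult_right_mono)
        moreover have "0 \<le> ?c * (g z / z)" using c gJ by (intro mult_nonneg_nonneg) auto
        ultimately show ?thesis by (simp only: distrib_left mult.assoc)
      qed
      then show ?thesis using True by simp
    next
      case False
      then have p0: "?p z = 0" by auto
      moreover have "0 \<le> ?q z" using g(3)[of z] s by (auto split: split_indicator)
      ultimately have "0 \<le> ?c * ?q z" using c by (intro mult_nonneg_nonneg) auto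
      then show ?thesis by (simp only: p0 mult_zero_right add_0_right)
    qed
  qed
  also have "\<dots> = ?c * (integral\<^sup>L lebesgue ?q + ?d * integral\<^sup>L lebesgue ?p)"
    using ip iq by (simp only: integral_mult_right_zero Bochner_Integration.integral_add integrable_mult_right)
  also have "\<dots> = ?c * (hardy_Q g s + iso_hardy_Q J g s)"
    using s by (simp add: hardy_Q_def iso_hardy_Q_def set_lebesgue_integral_def)
  finally show ?thesis by (simp add: set_lebesgue_integral_def)
qed

end

section \<open>Recovering the rearrangement from its increments\<close>

locale positive_lipschitz_setting = positive_isoperimetric_setting + lipschitz_setting
begin

text \<open>\<open>R\<close> is telescoped over the grid points from \<open>s\<close> to
  \<open>1/2\<close>, where it is nonpositive. The factor \<open>1 + 1 / p\<close> pays for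
  replacing \<open>J\<close> at the left end of a cell by \<open>J\<close> at its right end.\<close>

lemma rearrangement_le_integral:
  assumes R0: "R (1/2) \<le> 0" and k: "0 < k" and s: "0 < s" "s < 1/2"
    and p: "0 < p" "real p \<le> real (2 * k) * s"
  shows "R (s + 1 / real (2 * k)) \<le>
     (1 + 1 / real p) * (LINT z:{s<..<1/2}|lebesgue. step (2 * k) (increments k) z / J z)"
proof -
  let ?g = "step (2 * k) (increments k)"
  let ?n = "real (2 * k)"
  let ?I = "LINT z:{s<..<1/2}|lebesgue. ?g z / J z"
  have n: "0 < ?n" using k by simp
  have half: "real k / ?n = 1/2" using k by simp
  have I: "0 \<le> ?I" using s by (intro integral_div_J_nonneg step_nonneg increments_nonneg)
  \<comment> \<open>The first grid point at or after \<open>s\<close>. Rounding up costs at most one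
    mesh, hence the shifted argument in the conclusion.\<close>
  define i where "i = nat \<lceil>?n * s\<rceil>"
  have "0 < ?n * s" using n s by simp
  then have i: "?n * s \<le> real i" "real i < ?n * s + 1" "p \<le> i"
    using p(2) unfolding i_def by linarith+
  have sx: "s \<le> real i / ?n" "real i / ?n \<le> s + 1 / ?n"
    using i n by (auto simp: field_simps)
  have "1 / ?n \<le> 1/2" using k by (simp add: field_simps)
  then have s1: "s + 1 / ?n < 1" using s by simp
  show ?thesis
  proof (cases "i < k")
    \<comment> \<open>Here \<open>s\<close> is within one mesh of \<open>1/2\<close>, so the shifted
      value of \<open>R\<close> is already nonpositive.\<close>
    case False
    then have "real k / ?n \<le> real i / ?n" using n by (intro divide_right_mono) auto
    then have "1/2 \<le> s + 1 / ?n" using sx half by linarith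
    then have "R (s + 1 / ?n) \<le> R (1/2)" using s1 by (intro rearrangement_antimono[OF u_measurable]) auto
    then show ?thesis using R0 I by (smt (verit) mult_nonneg_nonneg divide_nonneg_nonneg of_nat_0_le_iff)
  next
    case True
    \<comment> \<open>As \<open>J t / t\<close> decreases, crossing cell \<open>j\<close> multiplies
      \<open>J\<close> by at most \<open>1 + 1 / j\<close>, and \<open>j \<ge> p\<close>.\<close>
    have J1: "J (real (Suc j) / ?n) \<le> (1 + 1 / real p) * J (real j / ?n)" if j: "j \<in> {i..<k}" for j
    proof -
      have j0: "0 < j" using j i p by auto
      have "J (real (Suc j) / ?n) * (real j / ?n) \<le> J (real j / ?n) * (real (Suc j) / ?n)"
        using grid_points[OF j0, of k] j by (intro J_ratio) auto
      then have "J (real (Suc j) / ?n) * real j \<le> J (real j / ?n) * real (Suc j)"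
        using n by (simp add: field_simps)
      then have "J (real (Suc j) / ?n) \<le> J (real j / ?n) * (1 + 1 / real j)"
        using j0 by (simp add: field_simps)
      also have "\<dots> \<le> J (real j / ?n) * (1 + 1 / real p)"
        using j i p grid_points[OF j0, of k] by (intro mult_left_mono add_left_mono divide_left_mono J_nonneg) auto
      finally show ?thesis by (simp add: mult.commute)
    qed
    have d: "R (real j / ?n) - R (real (Suc j) / ?n) \<le>
        (1 + 1 / real p) * (increments k j / J (real (Suc j) / ?n) * (1 / ?n))" if j: "j \<in> {i..<k}" for j
    proof -
      have j0: "0 < j" "j < k" using j i p by auto
      note gp = grid_points[OF j0]
      have Jp: "0 < J (real j / ?n)" "0 < J (real (Suc j) / ?n)" using gp less_le_trans[OF gp(1,2)] by (intro J_pos; linarith)+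
      let ?D = "R (real j / ?n) - R (real (Suc j) / ?n)"
      have "R (real (Suc j) / ?n) \<le> R (real j / ?n)"
        using gp(3) by (intro rearrangement_antimono[OF u_measurable gp(1,2)]) linarith
      then have D: "0 \<le> ?D" by linarith
      have "?D * J (real (Suc j) / ?n) \<le> ?D * ((1 + 1 / real p) * J (real j / ?n))"
        using J1[OF j] D by (rule mult_left_mono)
      then have "?D \<le> ?D * ((1 + 1 / real p) * J (real j / ?n)) / J (real (Suc j) / ?n)"
        using Jp by (simp only: pos_le_divide_eq)
      moreover have "increments k j / ?n = J (real j / ?n) * ?D" using j0 by (simp add: increments_def)
      ultimately show ?thesis by (simp add: mult_ac)
    qed
    have "(\<Sum>j = i..<k. R (real j / ?n) - R (real (Suc j) / ?n)) = R (real i / ?n) - R (real k / ?n)"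
      using sum_Suc_diff'[of i k "\<lambda>j. - R (real j / ?n)"] True by simp
    then have "R (real i / ?n) \<le> (\<Sum>j = i..<k. R (real j / ?n) - R (real (Suc j) / ?n))"
      using R0 unfolding half by simp
    also have "\<dots> \<le> (\<Sum>j = i..<k. (1 + 1 / real p) * (increments k j / J (real (Suc j) / ?n) * (1 / ?n)))"
      using d by (rule sum_mono)
    also have "\<dots> = (1 + 1 / real p) * (\<Sum>j = i..<k. increments k j / J (real (Suc j) / ?n) * (1 / ?n))"
      by (rule sum_distrib_left[symmetric])
    also have "(\<Sum>j = i..<k. increments k j / J (real (Suc j) / ?n) * (1 / ?n)) \<le> ?I"
    proof -
      let ?c = "\<lambda>j. {real j / ?n<..<real (Suc j) / ?n}"
      let ?F = "\<lambda>z. \<Sum>j = i..<k. increments k j / J (real (Suc j) / ?n) * indicator (?c j) z"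
      have len: "measure lebesgue (?c j) = 1 / ?n" for j
        using n by (simp add: divide_right_mono diff_divide_distrib[symmetric])
      have int: "integrable lebesgue (\<lambda>z. increments k j / J (real (Suc j) / ?n) * indicator (?c j) z)" for j
        by (intro integrable_mult_right integrable_real_indicator) (auto simp: divide_right_mono)
      have "(\<Sum>j = i..<k. increments k j / J (real (Suc j) / ?n) * (1 / ?n)) = integral\<^sup>L lebesgue ?F"
        using int len by (subst Bochner_Integration.integral_sum) (auto simp del: of_nat_Suc simp: mult.commute)
      also have "\<dots> \<le> integral\<^sup>L lebesgue (\<lambda>z. indicator {s<..<1/2} z *\<^sub>R (?g z / J z))"
      proof (rule integral_mono)
        show "integrable lebesgue ?F" using int by (intro Bochner_Integration.integrable_sum) 
        show "integrable lebesgue (\<lambda>z. indicator {s<..<1/2} z *\<^sub>R (?g z / J z))"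
          using set_integrable_div_J[OF borel_measurable_step step_bounded s(1)] k
          by (simp add: set_integrable_def)
        fix z :: real
        have nonneg: "0 \<le> indicator {s<..<1/2} z *\<^sub>R (?g z / J z)"
          using s J_nonneg[of z] step_nonneg[of "increments k" "2 * k" z] increments_nonneg by (auto split: split_indicator)
        show "?F z \<le> indicator {s<..<1/2} z *\<^sub>R (?g z / J z)"
        proof (cases "\<exists>j\<in>{i..<k}. z \<in> ?c j")
          case True
          then obtain j where j: "j \<in> {i..<k}" "z \<in> ?c j" by blast
          then have j0: "0 < j" "j < k" using i p by auto
          note gp = grid_points[OF j0]
          have zj: "real j < ?n * z" "?n * z < real j + 1" using j(2) n by (auto simp: field_simps)
          then have fl: "nat \<lfloor>?n * z\<rfloor> = j" by linarith
          have "?F z = (\<Sum>l\<in>{j}. increments k l / J (real (Suc l) / ?n) * indicator (?c l) z)"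
          proof (rule sum.mono_neutral_right)
            show "\<forall>l\<in>{i..<k} - {j}. increments k l / J (real (Suc l) / ?n) * indicator (?c l) z = 0"
            proof
              fix l assume l: "l \<in> {i..<k} - {j}"
              have "z \<notin> ?c l"
              proof
                assume "z \<in> ?c l"
                then have "real l < ?n * z" "?n * z < real l + 1" using n by (auto simp: field_simps)
                then have "l = j" using zj by linarith
                then show False using l by simp
              qed
              then show "increments k l / J (real (Suc l) / ?n) * indicator (?c l) z = 0" by simp
            qed
          qed (use j in auto)
          also have "\<dots> = increments k j / J (real (Suc j) / ?n)" using j(2) by simp
          also have "\<dots> \<le> increments k j / J z"
          proof (rule divide_left_mono)
            have z: "0 < z" "z \<le> real (Suc j) / ?n" using j(2) gp by auto
            then show "J z \<le> J (real (Suc j) / ?n)" using gp(3) by (intro J_mono) auto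
            show "0 < J (real (Suc j) / ?n) * J z" using z gp by (intro mult_pos_pos J_pos; linarith)
          qed (rule increments_nonneg)
          also have "\<dots> = indicator {s<..<1/2} z *\<^sub>R (?g z / J z)"
          proof -
            have "real i / ?n \<le> real j / ?n" using j(1) n by (intro divide_right_mono) auto
            then have "s < z" "z < 1/2" using sx(1) j(2)[unfolded greaterThanLessThan_iff] gp(3) by linarith+
            then show ?thesis using fl by (simp add: step_def)
          qed
          finally show ?thesis .
        next
          case False
          then have "?F z = 0" by (intro sum.neutral) auto
          then show ?thesis using nonneg by simp
        qed
      qed
      finally show ?thesis by (simp add: set_lebesgue_integral_def)
    qed
    finally have "R (real i / ?n) \<le> (1 + 1 / real p) * ?I" by (simp add: mult_left_mono)
    moreover have "R (s + 1 / ?n) \<le> R (real i / ?n)"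
      using sx s s1 by (intro rearrangement_antimono[OF u_measurable]) auto
    ultimately show ?thesis by simp
  qed
qed

end

lemma hardy_Q_scale: "hardy_Q (\<lambda>x. c * g x) = (\<lambda>t. c * hardy_Q g t)"
  by (simp add: hardy_Q_def fun_eq_iff flip: times_divide_eq_right)

lemma iso_hardy_Q_scale: "iso_hardy_Q J (\<lambda>x. c * g x) = (\<lambda>t. c * iso_hardy_Q J g t)"
  by (simp add: iso_hardy_Q_def fun_eq_iff flip: times_divide_eq_right)

lemma set_integral_AE_zero:
  fixes g w :: "real \<Rightarrow> real"
  assumes "AE x in unit_measure. g x = 0" "0 < s" "b \<le> 1"
  shows "(LINT z:{s<..<b}|lebesgue. g z / w z) = 0"
  unfolding set_lebesgue_integral_def
proof (rule integral_eq_zero_AE)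
  have "AE x in lebesgue. x \<in> {0<..<1} \<longrightarrow> g x = 0"
    using assms(1) by (subst (asm) AE_restrict_space_iff) auto
  then show "AE x in lebesgue. indicator {s<..<b} x *\<^sub>R (g x / w x) = 0"
    by eventually_elim (use assms in \<open>auto split: split_indicator\<close>)
qed

section \<open>Norm estimates for the Hardy operators\<close>

context function_norm
begin

text \<open>Scaling \<open>g\<close> to norm 1 gives the bound. If \<open>N g = 0\<close>, the right
  side is 0 even for an infinite operator norm, which is why the vanishing of \<open>N (T g)\<close>
  is a separate assumption.\<close>

lemma norm_le_op_norm:
  assumes g: "g \<in> bfs_carrier N" and T: "T g \<in> borel_measurable unit_measure"
    and scale: "\<And>c. T (\<lambda>x. c * g x) = (\<lambda>x. c * T g x)" and zero: "N g = 0 \<Longrightarrow> N (T g) = 0"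
  shows "N (T g) \<le> op_norm N T * N g"
proof (cases "N g = 0")
  case False
  have gm: "g \<in> borel_measurable unit_measure" using g by (simp add: bfs_carrier_def)
  obtain r where r: "N g = ennreal r" "0 < r"
    using g False by (cases "N g") (auto simp: bfs_carrier_def less_le)
  define c where "c = 1 / r"
  have c: "0 < c" "r * c = 1" using r by (auto simp: c_def)
  have "N (\<lambda>x. c * g x) = ennreal c * ennreal r" using c by (simp add: norm_scale[OF gm] r)
  also have "\<dots> = 1" using c r by (simp add: mult.commute flip: ennreal_mult)
  finally have 1: "N (\<lambda>x. c * g x) = 1" .
  then have "(\<lambda>x. c * g x) \<in> {h \<in> bfs_carrier N. N h \<le> 1}" using gm by (simp add: bfs_carrier_def)
  then have "N (T (\<lambda>x. c * g x)) \<le> op_norm N T" unfolding op_norm_def by (rule SUP_upper)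
  then have "ennreal c * N (T g) \<le> op_norm N T" using c by (simp add: scale norm_scale[OF T])
  then have "ennreal r * (ennreal c * N (T g)) \<le> ennreal r * op_norm N T" by (intro mult_left_mono) auto
  moreover have "ennreal r * (ennreal c * N (T g)) = N (T g)"
    using c r by (simp flip: mult.assoc ennreal_mult)
  ultimately show ?thesis by (simp add: r mult.commute)
qed (simp add: zero)

text \<open>For nonnegative bounded \<open>g\<close> the function \<open>hardy_Q g\<close> is
  decreasing, hence measurable. For \<open>iso_hardy_Q\<close> measurability is instead part of the
  assumed boundedness.\<close>

lemma norm_hardy_Q_le:
  assumes g: "g \<in> borel_measurable borel" "\<And>z. 0 < z \<Longrightarrow> z < 1 \<Longrightarrow> \<bar>g z\<bar> \<le> B" "\<And>z. 0 \<le> g z"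
  shows "hardy_Q g \<in> borel_measurable unit_measure" "N (hardy_Q g) \<le> op_norm N hardy_Q * N g"
proof -
  have gm: "g \<in> borel_measurable unit_measure" using g(1) by (rule borel_measurable_unit_measure)
  show Qm: "hardy_Q g \<in> borel_measurable unit_measure"
    by (intro borel_measurable_unit_measure_antimono monotone_onI hardy_Q_antimono[OF g]) auto
  show "N (hardy_Q g) \<le> op_norm N hardy_Q * N g"
  proof (rule norm_le_op_norm[where T = hardy_Q, OF _ Qm hardy_Q_scale])
    show "g \<in> bfs_carrier N" using norm_bounded_finite[OF gm g(2)] gm by (simp add: bfs_carrier_def)
    assume "N g = 0"
    then have "AE x in unit_measure. g x = 0" using norm_eq_0[OF gm] by simp
    then have "hardy_Q g t = 0" if "0 < t" for t
      unfolding hardy_Q_def using that by (intro set_integral_AE_zero) auto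
    then show "N (hardy_Q g) = 0"
      unfolding norm_eq_0[OF Qm] by (intro AE_unit_measureI)
  qed
qed

lemma norm_iso_hardy_Q_le:
  assumes b: "bounded_on N (iso_hardy_Q J)" and g: "g \<in> bfs_carrier N"
  shows "iso_hardy_Q J g \<in> borel_measurable unit_measure" "N (iso_hardy_Q J g) \<le> op_norm N (iso_hardy_Q J) * N g"
proof -
  have gm: "g \<in> borel_measurable unit_measure" using g by (simp add: bfs_carrier_def)
  show Qm: "iso_hardy_Q J g \<in> borel_measurable unit_measure"
    using b g by (auto simp: bounded_on_def bfs_carrier_def)
  show "N (iso_hardy_Q J g) \<le> op_norm N (iso_hardy_Q J) * N g"
  proof (rule norm_le_op_norm[where T = "iso_hardy_Q J", OF g Qm iso_hardy_Q_scale])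
    assume "N g = 0"
    then have "AE x in unit_measure. g x = 0" using norm_eq_0[OF gm] by simp
    then have "iso_hardy_Q J g t = 0" for t
      unfolding iso_hardy_Q_def using set_integral_AE_zero[of g t "1/2" J] by auto
    then show "N (iso_hardy_Q J g) = 0"
      unfolding norm_eq_0[OF Qm] by (intro AE_unit_measureI)
  qed
qed

end

text \<open>\<open>u\<close> stands for \<open>f - m\<close>, so 0 is a median. All of the weighted
  inequality except the integration against \<open>G\<close> is contained in this bound for a single
  \<open>t\<close>.\<close>

lemma (in ri_function_norm) norm_truncated_rearrangement_le:
  assumes "positive_lipschitz_setting M J u L" and b: "bounded_on N (iso_hardy_Q J)"
    and med: "is_median M u 0" and t: "0 < t" "t < 1/2"
  shows "N (\<lambda>s. rearrangement M u s * indicator {0..<t} s) \<le>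
    ennreal (t / J t) * ((op_norm N hardy_Q + op_norm N (iso_hardy_Q J)) * N (rearrangement M (grad_modulus u)))"
proof -
  interpret positive_lipschitz_setting M J u L by fact
  let ?X = "(op_norm N hardy_Q + op_norm N (iso_hardy_Q J)) * N (rearrangement M grad)"
  have msets: "{x. \<tau> < u x} \<in> sets M" "{x. u x \<le> \<tau>} \<in> sets M" for \<tau>
    using measurable_sets[OF u_measurable, of "{\<tau><..}"] measurable_sets[OF u_measurable, of "{..\<tau>}"]
    by (auto simp: vimage_def)
  have R_half: "R (1/2) \<le> 0"
  proof -
    have "{x. 0 < u x} = UNIV - {x. u x \<le> 0}" by auto
    then have "measure M {x. 0 < u x} = 1 - measure M {x. u x \<le> 0}"
      using prob_compl[OF msets(2)[of 0]] by simp
    also have "\<dots> \<le> 1/2" using med by (simp add: is_median_def)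
    finally show ?thesis by (subst rearrangement_le_iff[OF u_measurable]) auto
  qed
  \<comment> \<open>The other half of the median condition. It makes the truncated rearrangement
    nonnegative, as the Fatou property requires, and decreasing.\<close>
  have R_nonneg: "0 \<le> R s" if s: "0 < s" "s < 1/2" for s
  proof (rule ccontr)
    assume neg: "\<not> 0 \<le> R s"
    have "measure M {x. 0 \<le> u x} \<le> measure M {x. R s < u x}"
      using neg msets by (intro finite_measure_mono) auto
    then have "1/2 \<le> measure M {x. R s < u x}" using med by (simp add: is_median_def)
    then show False using rearrangement_le_iff[OF u_measurable, of s "R s"] s by simp
  qed
  have R_anti: "R s' \<le> R s" if "0 < s" "s \<le> s'" "s' < 1" for s s'
    using that by (rule rearrangement_antimono[OF u_measurable])
  \<comment> \<open>On \<open>[2\<^sup>-\<^sup>k, t)\<close> the grid of mesh \<open>h k\<close> costs only a factor \<open>1 + 2\<^sup>-\<^sup>k\<close>, and shifting the argument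
    by \<open>h k\<close> makes \<open>F k\<close> increase to the truncated rearrangement, so that the Fatou property applies.\<close>
  define h where "h k = 1 / real (2 * 4 ^ k)" for k :: nat
  have h: "0 < h k" "h k \<le> 1/2" "h (Suc k) \<le> h k" for k
  proof -
    have "(1::real) \<le> 4 ^ k" by simp
    then have "1 / (2 * (4::real) ^ k) \<le> 1 / 2" by (intro divide_left_mono) auto
    then show "0 < h k" "h k \<le> 1/2" "h (Suc k) \<le> h k" by (auto simp: h_def field_simps)
  qed
  have h0: "h \<longlonglongrightarrow> 0"
  proof -
    have "(\<lambda>k. (1/2) * (1/4::real) ^ k) \<longlonglongrightarrow> (1/2) * 0"
      by (intro tendsto_mult tendsto_const LIMSEQ_power_zero) auto
    then show ?thesis by (simp add: h_def[abs_def] power_one_over)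
  qed
  \<comment> \<open>The \<open>max\<close> is there because \<open>R (s + h k)\<close> can be
    negative once \<open>s + h k\<close> passes \<open>1/2\<close>. The cut at \<open>1/2\<close>
    keeps \<open>s + h k\<close> below 1, so \<open>P k\<close> is decreasing on
    \<open>(0,1)\<close> and thus measurable.\<close>
  define P where "P k s = (if s < 1/2 then max 0 (R (s + h k)) else 0)" for k s
  define F where "F k s = P k s * indicator {(1/2) ^ k..<t} s" for k s
  let ?f = "\<lambda>s. R s * indicator {0..<t} s"
  have Fm: "F k \<in> borel_measurable unit_measure" for k
  proof -
    have "antimono_on {0<..<1} (P k)"
    proof (rule monotone_onI)
      fix s s' :: real assume s: "s \<in> {0<..<1}" "s' \<in> {0<..<1}" "s \<le> s'"
      show "P k s' \<le> P k s"
      proof (cases "s' < 1/2")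
        case True
        then have "R (s' + h k) \<le> R (s + h k)" using s h(1,2)[of k] by (intro R_anti) auto
        then show ?thesis using True s by (auto simp: P_def)
      qed (auto simp: P_def)
    qed
    then have "P k \<in> borel_measurable unit_measure" by (rule borel_measurable_unit_measure_antimono)
    moreover have "(\<lambda>s. indicator {(1/2) ^ k..<t} s :: real) \<in> borel_measurable unit_measure"
      by (intro borel_measurable_unit_measure) measurable
    ultimately show ?thesis unfolding F_def[abs_def] by (rule borel_measurable_times)
  qed
  have fm: "?f \<in> borel_measurable unit_measure"
  proof (intro borel_measurable_unit_measure_antimono monotone_onI)
    fix s s' :: real assume s: "s \<in> {0<..<1}" "s' \<in> {0<..<1}" "s \<le> s'"
    show "R s' * indicator {0..<t} s' \<le> R s * indicator {0..<t} s"
      using s t R_nonneg[of s] R_anti[of s s'] by (auto split: split_indicator)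
  qed
  have bound: "N (F k) \<le> ennreal (1 + 1 / 2 ^ k) * (ennreal (t / J t) * ?X)" for k
  proof -
    let ?g = "step (2 * 4 ^ k) (increments (4 ^ k))"
    let ?c = "(1 + 1 / 2 ^ k) * (t / J t)"
    have k4: "0 < (4::nat) ^ k" by simp
    have Jt: "0 < J t" using t by (intro J_pos) auto
    then have c: "0 \<le> ?c" "0 \<le> t / J t" using t by auto
    have g: "?g \<in> borel_measurable borel" "\<And>z. 0 < z \<Longrightarrow> z < 1 \<Longrightarrow> \<bar>?g z\<bar> \<le> (\<Sum>i<2 * 4 ^ k. \<bar>increments (4 ^ k) i\<bar>)"
      "\<And>z. 0 \<le> ?g z"
      using step_bounded[of "2 * 4 ^ k"] by (auto intro: step_nonneg increments_nonneg)
    have gc: "?g \<in> bfs_carrier N"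
      using norm_step_finite[of "2 * 4 ^ k"] step_measurable by (simp add: bfs_carrier_def)
    note Q = norm_hardy_Q_le[OF g] and QJ = norm_iso_hardy_Q_le[OF b gc]
    let ?S = "\<lambda>s. hardy_Q ?g s + iso_hardy_Q J ?g s"
    have Sm: "?S \<in> borel_measurable unit_measure" using Q(1) QJ(1) by (rule borel_measurable_add)
    have Npos: "0 \<le> ?S s" if "0 < s" for s
    proof (rule add_nonneg_nonneg)
      show "0 \<le> hardy_Q ?g s" using that by (intro hardy_Q_nonneg g(3))
      show "0 \<le> iso_hardy_Q J ?g s"
        using integral_div_J_nonneg[OF g(3), of s] J_nonneg[of s] that by (auto simp: iso_hardy_Q_def)
    qed
    have "N (F k) \<le> N (\<lambda>s. ?c * ?S s)"
    proof (rule norm_mono[OF Fm])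
      show "(\<lambda>s. ?c * ?S s) \<in> borel_measurable unit_measure" using Sm by (intro borel_measurable_times) auto
      fix s :: real assume s: "0 < s" "s < 1"
      have r: "0 \<le> ?c * ?S s" using c Npos s by (intro mult_nonneg_nonneg) auto
      have "F k s \<le> ?c * ?S s"
      proof (cases "(1/2) ^ k \<le> s \<and> s < t")
        case True
        \<comment> \<open>The cutoff \<open>s \<ge> 2^-k\<close> makes \<open>2 * 4^k * s\<close> at
          least \<open>2^k\<close>, the value taken for \<open>p\<close>.\<close>
        have "2 ^ k * 1 \<le> 2 ^ k * (2 ^ k * s)"
        proof (rule mult_left_mono)
          have "2 ^ k * (1/2) ^ k \<le> 2 ^ k * s" using True by (intro mult_left_mono) auto
          then show "1 \<le> 2 ^ k * s" by (simp add: power_one_over)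
        qed simp
        also have "2 ^ k * (2 ^ k * s) \<le> 2 * (4 ^ k * s)"
          using s by (simp add: flip: power_mult_distrib mult.assoc)
        finally have p: "real (2 ^ k) \<le> real (2 * 4 ^ k) * s" by simp
        have "R (s + 1 / real (2 * 4 ^ k)) \<le> (1 + 1 / real (2 ^ k)) * (LINT z:{s<..<1/2}|lebesgue. ?g z / J z)"
          using True t s by (intro rearrangement_le_integral R_half p k4) auto
        also have "\<dots> \<le> (1 + 1 / real (2 ^ k)) * (t / J t * ?S s)"
          using True t s by (intro mult_left_mono integral_div_J_le[OF g]) auto
        finally have "R (s + h k) \<le> ?c * ?S s" by (simp add: h_def)
        then show ?thesis using True t r by (simp add: F_def P_def)
      next
        case False
        then have "F k s = 0" by (auto simp: F_def)
        then show ?thesis using r by simp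
      qed
      moreover have "0 \<le> F k s" by (auto simp: F_def P_def)
      ultimately show "\<bar>F k s\<bar> \<le> \<bar>?c * ?S s\<bar>" using r by (simp only: abs_of_nonneg)
    qed
    also have "\<dots> = ennreal ?c * N ?S" by (simp only: norm_scale[OF Sm] abs_of_nonneg[OF c(1)])
    also have "\<dots> \<le> ennreal ?c * ?X"
    proof (rule mult_left_mono)
      have "N ?S \<le> N (hardy_Q ?g) + N (iso_hardy_Q J ?g)" using Q(1) QJ(1) by (rule norm_triangle)
      also have "\<dots> \<le> (op_norm N hardy_Q + op_norm N (iso_hardy_Q J)) * N ?g"
        using Q(2) QJ(2) by (simp add: distrib_right add_mono)
      also have "\<dots> \<le> ?X"
        by (intro mult_left_mono norm_increments_le[OF lipschitz_setting_axioms k4]) simp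
      finally show "N ?S \<le> ?X" .
    qed simp
    also have "ennreal ?c * ?X = ennreal (1 + 1 / 2 ^ k) * (ennreal (t / J t) * ?X)"
      using c(2) by (subst ennreal_mult) (auto simp: mult.assoc)
    finally show ?thesis .
  qed
  have NF: "(\<lambda>k. N (F k)) \<longlonglongrightarrow> N ?f"
  proof (rule norm_fatou[OF fm Fm], rule AE_unit_measureI, intro conjI allI)
    fix s :: real and k assume s: "0 < s" "s < 1"
    show "0 \<le> F k s" by (auto simp: F_def P_def)
    show "F k s \<le> F (Suc k) s"
    proof (cases "(1/2) ^ k \<le> s \<and> s < t")
      case True
      have "(1/2::real) ^ Suc k \<le> (1/2) ^ k" by simp
      then have "(1/2) ^ Suc k \<le> s" using True by linarith
      moreover have "R (s + h k) \<le> R (s + h (Suc k))"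
        using True s t h(1)[of "Suc k"] h(2,3)[of k] by (intro R_anti) auto
      ultimately show ?thesis using True t by (auto simp: F_def P_def simp del: power_Suc)
    next
      case False
      then have "F k s = 0" by (auto simp: F_def)
      then show ?thesis by (auto simp: F_def P_def)
    qed
  next
    fix s :: real assume s: "0 < s" "s < 1"
    show "(\<lambda>k. F k s) \<longlonglongrightarrow> R s * indicator {0..<t} s"
    proof (cases "s < t")
      case True
      have "(\<lambda>k. max 0 (R (s + h k))) \<longlonglongrightarrow> max 0 (R s)"
        using s by (intro tendsto_max tendsto_const rearrangement_right_continuous[OF u_measurable] h0 h)
      moreover have "\<forall>\<^sub>F k in sequentially. max 0 (R (s + h k)) = F k s"
      proof -
        have "(\<lambda>k. (1/2::real) ^ k) \<longlonglongrightarrow> 0" by (intro LIMSEQ_power_zero) auto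
        then have "\<forall>\<^sub>F k in sequentially. (1/2) ^ k < s" using s by (intro order_tendstoD(2))
        then show ?thesis by eventually_elim (use True t in \<open>auto simp: F_def P_def\<close>)
      qed
      ultimately have "(\<lambda>k. F k s) \<longlonglongrightarrow> max 0 (R s)" by (rule Lim_transform_eventually)
      then show ?thesis using True s t R_nonneg[of s] by (simp add: max_absorb2)
    qed (simp add: F_def)
  qed
  show ?thesis
  \<comment> \<open>An infinite bound is trivial; for a finite one the limit of the factors
    \<open>1 + 2^-k\<close> is taken in the reals.\<close>
  proof (cases "ennreal (t / J t) * ?X" rule: ennreal_cases)
    case (real b)
    then have b: "ennreal (t / J t) * ?X = ennreal b" "0 \<le> b" by auto
    have "(\<lambda>k. (1 + (1/2) ^ k) * b) \<longlonglongrightarrow> (1 + 0) * b"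
      by (intro tendsto_intros LIMSEQ_power_zero) auto
    then have lim: "(\<lambda>k. ennreal ((1 + (1/2) ^ k) * b)) \<longlonglongrightarrow> ennreal b" by (intro tendsto_ennrealI) simp
    have "N (F k) \<le> ennreal ((1 + (1/2) ^ k) * b)" for k
      using bound[of k] b by (simp add: power_one_over ennreal_mult)
    then show ?thesis unfolding b(1)
      by (intro LIMSEQ_le[OF NF lim]) auto
  qed simp
qed

text \<open>If \<open>J\<close> vanished at \<open>t0\<close>, it would vanish on all of
  \<open>(0, t0)\<close> by monotonicity. There a positive number divided by 0 is infinite in
  \<open>ennreal\<close>, and so is its product with \<open>G t > 0\<close>; the weight integral
  would diverge.\<close>

lemma (in isoperimetric_setting) J_pos_of_integrable:
  assumes G: "\<forall>t\<in>{0<..<1}. 0 < G t"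
    and fin: "(\<integral>\<^sup>+t\<in>{0<..<1/2}. (ennreal t / ennreal (J t) * ennreal (G t)) \<partial>lebesgue) < \<infinity>"
    and t0: "0 < t0" "t0 \<le> 1/2"
  shows "0 < J t0"
proof (rule ccontr)
  assume "\<not> 0 < J t0"
  then have J0: "J t = 0" if "0 < t" "t < t0" for t
    using J_mono[of t t0] J_nonneg[of t] that t0 by simp
  have "\<infinity> = (\<integral>\<^sup>+t. \<infinity> * indicator {0<..<t0} t \<partial>lebesgue)"
    using t0 by (subst nn_integral_cmult_indicator) (auto simp: ennreal_top_mult)
  also have "\<dots> \<le> (\<integral>\<^sup>+t\<in>{0<..<1/2}. (ennreal t / ennreal (J t) * ennreal (G t)) \<partial>lebesgue)"
  proof (intro nn_integral_mono)
    fix t :: real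
    show "\<infinity> * indicator {0<..<t0} t \<le> ennreal t / ennreal (J t) * ennreal (G t) * indicator {0<..<1/2} t"
    proof (cases "t \<in> {0<..<t0}")
      case True
      then have "0 < G t" using G t0 by auto
      then show ?thesis using True t0 J0[of t] by (simp add: divide_ennreal_def ennreal_top_mult ennreal_mult_top)
    qed simp
  qed
  finally show False using fin by simp
qed

lemma is_median_shift: "is_median M f m \<Longrightarrow> is_median M (\<lambda>x. f x - m) 0"
  by (simp add: is_median_def)

lemma grad_modulus_shift: "grad_modulus (\<lambda>x. f x - m) = grad_modulus f"
  by (simp add: grad_modulus_def fun_eq_iff)

theorem theorem3:
  fixes M :: "'a::metric_space measure"
    and J G :: "real \<Rightarrow> real"
    and N :: "(real \<Rightarrow> real) \<Rightarrow> ennreal"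
    and f :: "'a \<Rightarrow> real"
    and m :: real
  assumes "isoperimetric_space M"
    and "isoperimetric_estimator M J"
    and "ri_norm N"
    and "G \<in> borel_measurable (lebesgue_on {0<..<1})"
    and "\<forall>t\<in>{0<..<1}. 0 < G t"
    and "(\<integral>\<^sup>+t\<in>{0<..<1/2}. (ennreal t / ennreal (J t) * ennreal (G t)) \<partial>lebesgue) < \<infinity>"
    and "bounded_on N (iso_hardy_Q J)"
    and "\<exists>L. L-lipschitz_on UNIV f"
    and "is_median M f m"
  shows "(\<integral>\<^sup>+t\<in>{0<..<1/2}.
            (N (\<lambda>s. rearrangement M (\<lambda>x. f x - m) s * indicator {0..<t} s) * ennreal (G t)) \<partial>lebesgue)
         \<le> (op_norm N hardy_Q + op_norm N (iso_hardy_Q J)) * N (rearrangement M (grad_modulus f)) *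
            (\<integral>\<^sup>+t\<in>{0<..<1/2}. (ennreal t / ennreal (J t) * ennreal (G t)) \<partial>lebesgue)"
proof -
  obtain L where L: "L-lipschitz_on UNIV f" using assms(8) by blast
  interpret isoperimetric_setting M J using assms(1,2) by unfold_locales
  interpret ri_function_norm N
    using assms(3) by unfold_locales (simp_all add: ri_norm_def)
  have Jp: "0 < J t" if "0 < t" "t \<le> 1/2" for t using assms(5,6) that by (rule J_pos_of_integrable)
  have "L-lipschitz_on UNIV (\<lambda>x. f x - m)"
    using L by (auto simp: lipschitz_on_def dist_real_def)
  then have setting: "positive_lipschitz_setting M J (\<lambda>x. f x - m) L"
    using Jp by unfold_locales
  let ?X = "(op_norm N hardy_Q + op_norm N (iso_hardy_Q J)) * N (rearrangement M (grad_modulus f))"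
  let ?w = "\<lambda>t. ennreal t / ennreal (J t) * ennreal (G t) * indicator {0<..<1/2} t"
  \<comment> \<open>Measurability of \<open>J\<close> and \<open>G\<close> is known only on
    \<open>[0, 1/2]\<close> and \<open>(0,1)\<close>; truncated copies agree with them on
    \<open>(0, 1/2)\<close>.\<close>
  have wm: "?w \<in> borel_measurable lebesgue"
  proof -
    have J': "(\<lambda>t. indicator {0..1/2} t *\<^sub>R J t) \<in> borel_measurable lebesgue"
    proof -
      have "(\<lambda>t. indicator {0..1/2} t *\<^sub>R J t) \<in> borel_measurable borel"
        by (intro borel_measurable_continuous_on_indicator continuous_on_J) simp
      then show ?thesis by (intro measurable_completion) simp
    qed
    have G': "(\<lambda>t. indicator {0<..<1} t *\<^sub>R G t) \<in> borel_measurable lebesgue"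
      using assms(4) by (subst (asm) borel_measurable_restrict_space_iff) auto
    have id: "(\<lambda>t::real. t) \<in> borel_measurable lebesgue" by (intro measurable_completion) simp
    have ind: "(\<lambda>t. indicator {0<..<1/2::real} t :: ennreal) \<in> borel_measurable lebesgue"
      by (intro borel_measurable_indicator) simp
    have "(\<lambda>t. ennreal t / ennreal (indicator {0..1/2} t *\<^sub>R J t) *
        ennreal (indicator {0<..<1} t *\<^sub>R G t) * indicator {0<..<1/2} t) \<in> borel_measurable lebesgue"
      using J' G' id ind by measurable
    then show ?thesis by (rule measurable_cong[THEN iffD1, rotated]) (auto split: split_indicator)
  qed
  have "(\<integral>\<^sup>+t\<in>{0<..<1/2}.
            (N (\<lambda>s. rearrangement M (\<lambda>x. f x - m) s * indicator {0..<t} s) * ennreal (G t)) \<partial>lebesgue)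
     \<le> (\<integral>\<^sup>+t. ?X * ?w t \<partial>lebesgue)"
  proof (rule nn_integral_mono)
    fix t :: real
    show "N (\<lambda>s. rearrangement M (\<lambda>x. f x - m) s * indicator {0..<t} s) * ennreal (G t) * indicator {0<..<1/2} t
       \<le> ?X * ?w t"
    proof (cases "t \<in> {0<..<1/2}")
      case True
      then have "N (\<lambda>s. rearrangement M (\<lambda>x. f x - m) s * indicator {0..<t} s) \<le> ennreal (t / J t) * ?X"
        using norm_truncated_rearrangement_le[OF setting assms(7) is_median_shift[OF assms(9)], of t]
        by (simp add: grad_modulus_shift)
      then have "N (\<lambda>s. rearrangement M (\<lambda>x. f x - m) s * indicator {0..<t} s) * ennreal (G t) \<le>
          ennreal (t / J t) * ?X * ennreal (G t)" by (intro mult_right_mono) auto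
      also have "ennreal (t / J t) = ennreal t / ennreal (J t)"
        using True Jp[of t] by (intro divide_ennreal[symmetric]) auto
      finally show ?thesis using True by (simp add: mult_ac)
    qed simp
  qed
  also have "\<dots> = ?X * (\<integral>\<^sup>+t. ?w t \<partial>lebesgue)" using wm by (rule nn_integral_cmult)
  finally show ?thesis .
qed

end
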